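(* Let $(X_t)_{t\ge0}$ be a real-valued additive process and let $S(t)=\sqrt{2t^\gamma\log\log(t\vee e^e)}$ for some $\gamma>0$. Suppose that $(X(t\,\cdot)/S(t))_{t>0}$ satisfies a moderate deviation principle in $(D[0,1],\|\cdot\|_\infty)$ with speed $S(t)^2/t^\gamma$ and good rate function $$I(f)=\begin{cases}\displaystyle\frac{1}{2\sigma^2\gamma}\int_0^1\frac{f'(s)^2}{s^{\gamma-1}}\,ds, & f:[0,1]\to\mathbb{R}\text{ absolutely continuous},\ f(0)=0,\\[2mm] \infty,&\text{otherwise,}\end{cases}$$ for some $\sigma>0$. Then $$\left\{\frac{X(t\,\cdot)}{\sqrt{2t^\gamma\log\log(t\vee e^e)}};\ t>0\right\}$$ is almost surely relatively compact in $(D[0,1],\|\cdot\|_\infty)$ as $t\to\infty$, and for almost all $\omega\in\Omega$ the set of limit points $\mathcal{L}(\omega)$ (as $t\to\infty$) is given by the sublevel set $\Phi(\tfrac12)=\{f\in D[0,1]: I(f)\le\tfrac12\}$.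
   Context: All processes live on a complete probability space $(\Omega,\mathcal{A},\mathbb{P})$. An additive process is a real-valued process $(X_t)_{t\ge0}$ with càdlàg sample paths, independent increments and $X_0=0$. $D[0,1]$ is the space of càdlàg functions $f:[0,1]\to\mathbb{R}$ with the uniform norm $\|\cdot\|_\infty$. $X(t\,\cdot)$ denotes the random function $[0,1]\ni s\mapsto X(ts)$. Standing assumption: for every $t>0$ the map $\omega\mapsto X(t\,\cdot,\omega)\in(D[0,1],\|\cdot\|_\infty)$ is measurable (Borel $\sigma$-algebra of the uniform norm). Moderate deviation principle (MDP): a family $(X^t)_{t>0}$ of random elements of a metric space $(M,d)$ satisfies a large deviation principle with good rate function $I:M\to[0,\infty]$ and speed $(a_t)_{t>0}\subseteq(0,\infty)$ if the sublevel sets $\{f\in M:I(f)\le r\}$ are compact, $a_t\to\infty$ as $t\to\infty$, and for all open $U\subseteq M$ and closed $F\subseteq M$: $-\inf_UI\le\liminf_{t\to\infty}\frac1{a_t}\log\mathbb{P}(X^t\in U)$ and $\limsup_{t\to\infty}\frac1{a_t}\log\mathbb{P}(X^t\in F)\le-\inf_FI$. For a square-integrable càdlàg process $X$ and $S:(0,\infty)\to(0,\infty)$ with $S(t)/\operatorname{Var}X_t\to0$ as $t\to\infty$, the family $(X(t\,\cdot)/S(t))_{t>0}$ satisfies an MDP with good rate function $I$ and speed $(a_t)$ if it satisfies a large deviation principle in $(D[0,1],\|\cdot\|_\infty)$ with that rate function and speed. "Relatively compact as $t\to\infty$" means that for every sequence $t_n\to\infty$ the sequence $X(t_n\,\cdot,\omega)/S(t_n)$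 has a subsequence converging in $(D[0,1],\|\cdot\|_\infty)$. $\mathcal{L}(\omega)$ is the set of all $f\in D[0,1]$ for which there is a sequence $t_n\to\infty$ with $\|X(t_n\,\cdot,\omega)/S(t_n)-f\|_\infty\to0$. *)

theory Defs
  imports "HOL-Probability.Probability"
begin

section \<open>The space D[0,1] with the uniform norm\<close>

text \<open>
  At an end point of \<open>S\<close> at which one of the two one-sided filters is trivial, the corresponding
  condition is void, so on \<open>{0..1}\<close> this asks for right continuity on \<open>[0,1)\<close> and left limits on
  \<open>(0,1]\<close>.
\<close>

definition cadlag_on :: "real set \<Rightarrow> (real \<Rightarrow> real) \<Rightarrow> bool" where
  "cadlag_on S f \<longleftrightarrow>
    (\<forall>t\<in>S. (f \<longlongrightarrow> f t) (at t within S \<inter> {t<..}) \<and>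
           (\<exists>l. (f \<longlongrightarrow> l) (at t within S \<inter> {..<t})))"

text \<open>
  A function on \<open>[0,1]\<close> is represented by its extension by \<open>0\<close> to the real line.
\<close>

typedef cadlag = "{f :: real \<Rightarrow> real. cadlag_on {0..1} f \<and> (\<forall>s. s \<notin> {0..1} \<longrightarrow> f s = 0)}"
  morphisms apply_cadlag Cadlag
  by (rule exI[of _ "\<lambda>_. 0"]) (auto simp: cadlag_on_def)

setup_lifting type_definition_cadlag

lemma cadlag_eqI: "(\<And>s. s \<in> {0..1} \<Longrightarrow> apply_cadlag f s = apply_cadlag g s) \<Longrightarrow> f = g"
  by transfer (metis ext)

lemma cadlag_on_bounded:
  assumes f: "cadlag_on {0..1} f"
  shows "\<exists>B. \<forall>s\<in>{0..1}. \<bar>f s\<bar> \<le> B"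
proof -
  define P where
    "P a b \<longleftrightarrow> (0 \<le> a \<and> b \<le> 1 \<longrightarrow> (\<exists>B. \<forall>s\<in>{a..b}. \<bar>f s\<bar> \<le> B))" for a b
  have side: "\<exists>B d. 0 < d \<and> (\<forall>s\<in>T. s \<noteq> x \<longrightarrow> dist s x < d \<longrightarrow> \<bar>f s\<bar> \<le> B)"
    if "(f \<longlongrightarrow> l) (at x within T)" for l x T
  proof -
    from that have "\<forall>\<^sub>F s in at x within T. dist (f s) l < 1"
      by (rule tendstoD) simp
    then obtain d where d: "d > 0" "\<And>s. s \<in> T \<Longrightarrow> s \<noteq> x \<Longrightarrow> dist s x < d \<Longrightarrow> dist (f s) l < 1"
      unfolding eventually_at by blast
    have "\<bar>f s\<bar> \<le> \<bar>l\<bar> + 1" if "s \<in> T" "s \<noteq> x" "dist s x < d" for s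
      using d(2)[OF that] by (auto simp: dist_real_def)
    with d(1) show ?thesis by blast
  qed
  have "P 0 1"
  proof (rule Bolzano)
    fix a b c assume P: "P a b" "P b c" and le: "a \<le> b" "b \<le> c"
    show "P a c"
      unfolding P_def
    proof
      assume "0 \<le> a \<and> c \<le> 1"
      with P le obtain B1 B2 where "\<forall>s\<in>{a..b}. \<bar>f s\<bar> \<le> B1" "\<forall>s\<in>{b..c}. \<bar>f s\<bar> \<le> B2"
        unfolding P_def by force
      then have "\<forall>s\<in>{a..c}. \<bar>f s\<bar> \<le> max B1 B2"
        by (metis atLeastAtMost_iff linorder_le_cases max.coboundedI1 max.coboundedI2)
      then show "\<exists>B. \<forall>s\<in>{a..c}. \<bar>f s\<bar> \<le> B" ..
    qed
  next
    fix x :: real assume x: "0 \<le> x" "x \<le> 1"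
    then have "(f \<longlongrightarrow> f x) (at x within {0..1} \<inter> {x<..})"
      using f by (simp add: cadlag_on_def)
    then obtain B1 d1 where 1: "0 < d1"
      "\<forall>s\<in>{0..1} \<inter> {x<..}. s \<noteq> x \<longrightarrow> dist s x < d1 \<longrightarrow> \<bar>f s\<bar> \<le> B1"
      using side by blast
    obtain l where "(f \<longlongrightarrow> l) (at x within {0..1} \<inter> {..<x})"
      using f x unfolding cadlag_on_def by (meson atLeastAtMost_iff)
    then obtain B2 d2 where 2: "0 < d2"
      "\<forall>s\<in>{0..1} \<inter> {..<x}. s \<noteq> x \<longrightarrow> dist s x < d2 \<longrightarrow> \<bar>f s\<bar> \<le> B2"
      using side by blast
    have "P a b" if ab: "a \<le> x" "x \<le> b" "b - a < min d1 d2" for a b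
      unfolding P_def
    proof
      assume "0 \<le> a \<and> b \<le> 1"
      then have "\<bar>f s\<bar> \<le> max (max B1 B2) \<bar>f x\<bar>" if s: "s \<in> {a..b}" for s
      proof (cases s x rule: linorder_cases)
        case less
        then have "\<bar>f s\<bar> \<le> B2"
          using 2(2) s ab \<open>0 \<le> a \<and> b \<le> 1\<close> by (auto simp: dist_real_def)
        then show ?thesis by linarith
      next
        case greater
        then have "\<bar>f s\<bar> \<le> B1"
          using 1(2) s ab \<open>0 \<le> a \<and> b \<le> 1\<close> by (auto simp: dist_real_def)
        then show ?thesis by linarith
      qed simp
      then show "\<exists>B. \<forall>s\<in>{a..b}. \<bar>f s\<bar> \<le> B" by blast
    qed
    then show "\<exists>d>0. \<forall>a b. a \<le> x \<and> x \<le> b \<and> b - a < d \<longrightarrow> P a b"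
      using 1(1) 2(1) by (intro exI[of _ "min d1 d2"]) auto
  qed simp
  then show ?thesis by (simp add: P_def)
qed

lemma bdd_above_apply_cadlag: "bdd_above ((\<lambda>s. \<bar>apply_cadlag f s\<bar>) ` {0..1})"
  using cadlag_on_bounded[of "apply_cadlag f"] apply_cadlag[of f] by (auto simp: bdd_above_def)

instantiation cadlag :: real_vector
begin

lift_definition zero_cadlag :: cadlag is "\<lambda>_. 0"
  by (auto simp: cadlag_on_def)

lift_definition plus_cadlag :: "cadlag \<Rightarrow> cadlag \<Rightarrow> cadlag" is "\<lambda>f g s. f s + g s"
  unfolding cadlag_on_def by (fastforce intro: tendsto_add)

lift_definition uminus_cadlag :: "cadlag \<Rightarrow> cadlag" is "\<lambda>f s. - f s"
  unfolding cadlag_on_def by (fastforce intro: tendsto_minus)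

lift_definition minus_cadlag :: "cadlag \<Rightarrow> cadlag \<Rightarrow> cadlag" is "\<lambda>f g s. f s - g s"
  unfolding cadlag_on_def by (fastforce intro: tendsto_diff)

lift_definition scaleR_cadlag :: "real \<Rightarrow> cadlag \<Rightarrow> cadlag" is "\<lambda>c f s. c * f s"
  unfolding cadlag_on_def by (fastforce intro: tendsto_mult_left)

instance
  by standard (transfer; auto simp: algebra_simps)+

end

lemmas apply_cadlag_simps =
  zero_cadlag.rep_eq plus_cadlag.rep_eq uminus_cadlag.rep_eq minus_cadlag.rep_eq scaleR_cadlag.rep_eq

instantiation cadlag :: real_normed_vector
begin

definition norm_cadlag :: "cadlag \<Rightarrow> real" where
  "norm_cadlag f = (SUP s\<in>{0..1}. \<bar>apply_cadlag f s\<bar>)"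

definition dist_cadlag :: "cadlag \<Rightarrow> cadlag \<Rightarrow> real" where
  "dist_cadlag f g = norm (f - g)"

definition sgn_cadlag :: "cadlag \<Rightarrow> cadlag" where
  "sgn_cadlag f = f /\<^sub>R norm f"

definition uniformity_cadlag :: "(cadlag \<times> cadlag) filter" where
  "uniformity_cadlag = (INF e\<in>{0 <..}. principal {(x, y). dist x y < e})"

definition open_cadlag :: "cadlag set \<Rightarrow> bool" where
  "open_cadlag S = (\<forall>x\<in>S. \<forall>\<^sub>F (x', y) in uniformity. x' = x \<longrightarrow> y \<in> S)"

lemma abs_apply_cadlag_le_norm: "s \<in> {0..1} \<Longrightarrow> \<bar>apply_cadlag f s\<bar> \<le> norm f"
  unfolding norm_cadlag_def by (rule cSUP_upper[OF _ bdd_above_apply_cadlag])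

lemma norm_cadlag_le: "(\<And>s. s \<in> {0..1} \<Longrightarrow> \<bar>apply_cadlag f s\<bar> \<le> b) \<Longrightarrow> norm f \<le> b"
  unfolding norm_cadlag_def by (rule cSUP_least) auto

instance
proof
  fix f g :: cadlag and a :: real
  show "norm f = 0 \<longleftrightarrow> f = 0"
  proof
    assume "norm f = 0"
    then show "f = 0"
      using abs_apply_cadlag_le_norm[of _ f]
      by (intro cadlag_eqI) (auto simp: apply_cadlag_simps)
  qed (simp add: norm_cadlag_def apply_cadlag_simps)
  show "norm (f + g) \<le> norm f + norm g"
  proof (rule norm_cadlag_le)
    fix s :: real assume "s \<in> {0..1}"
    then show "\<bar>apply_cadlag (f + g) s\<bar> \<le> norm f + norm g"
      using abs_apply_cadlag_le_norm[of s f] abs_apply_cadlag_le_norm[of s g]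
      by (auto simp: apply_cadlag_simps)
  qed
  have le: "norm (c *\<^sub>R h) \<le> \<bar>c\<bar> * norm h" for c and h :: cadlag
    by (rule norm_cadlag_le)
      (auto simp: apply_cadlag_simps abs_mult intro!: mult_left_mono abs_apply_cadlag_le_norm)
  show "norm (a *\<^sub>R f) = \<bar>a\<bar> * norm f"
  proof (cases "a = 0")
    case True
    then show ?thesis by (simp add: norm_cadlag_def apply_cadlag_simps)
  next
    case False
    have "\<bar>a\<bar> * norm f = \<bar>a\<bar> * norm (inverse a *\<^sub>R a *\<^sub>R f)"
      using False by simp
    also have "\<dots> \<le> \<bar>a\<bar> * (\<bar>inverse a\<bar> * norm (a *\<^sub>R f))"
      by (intro mult_left_mono le) auto
    also have "\<dots> = norm (a *\<^sub>R f)"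
      using False by simp
    finally show ?thesis using le[of a f] by simp
  qed
qed (simp_all add: dist_cadlag_def sgn_cadlag_def uniformity_cadlag_def open_cadlag_def)

end

text \<open>
  For a function \<open>x\<close> that is cadlag on \<open>[0,\<infinity>)\<close> and \<open>t > 0\<close>, this is the element \<open>x(t \<cdot>)\<close> of D[0,1].
  (Outside of that case the value of \<open>Cadlag\<close> is unspecified.)
\<close>

definition rescaled_path :: "(real \<Rightarrow> real) \<Rightarrow> real \<Rightarrow> cadlag" where
  "rescaled_path x t = Cadlag (\<lambda>s. if s \<in> {0..1} then x (t * s) else 0)"

lemma apply_rescaled_path:
  assumes x: "cadlag_on {0..} x" and t: "t > 0"
  shows "apply_cadlag (rescaled_path x t) s = (if s \<in> {0..1} then x (t * s) else 0)"
proof -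
  define g where "g = (\<lambda>s. if s \<in> {0..1} then x (t * s) else 0)"
  have lim: "(g \<longlongrightarrow> l) (at s within {0..1} \<inter> A)"
    if l: "(x \<longlongrightarrow> l) (at (t * s) within {0..} \<inter> B)" and AB: "\<And>u. u \<in> A \<Longrightarrow> t * u \<in> B"
    for l s A B
  proof -
    have "filterlim (\<lambda>u. t * u) (at (t * s) within {0..} \<inter> B) (at s within {0..1} \<inter> A)"
      unfolding filterlim_at using t AB
      by (auto simp: eventually_at_filter intro!: tendsto_intros)
    from filterlim_compose[OF l this]
    have "((\<lambda>u. x (t * u)) \<longlongrightarrow> l) (at s within {0..1} \<inter> A)" .
    then show ?thesis
      by (rule Lim_transform_eventually) (auto simp: g_def eventually_at_filter)
  qed
  have "cadlag_on {0..1} g"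
    unfolding cadlag_on_def
  proof (intro ballI conjI)
    fix s :: real assume s: "s \<in> {0..1}"
    then have ts: "t * s \<in> {0..}" using t by simp
    have "(x \<longlongrightarrow> g s) (at (t * s) within {0..} \<inter> {t * s<..})"
      using x ts s by (auto simp: cadlag_on_def g_def)
    then show "(g \<longlongrightarrow> g s) (at s within {0..1} \<inter> {s<..})"
      by (rule lim) (use t in auto)
    obtain l where "(x \<longlongrightarrow> l) (at (t * s) within {0..} \<inter> {..<t * s})"
      using x ts unfolding cadlag_on_def by blast
    then have "(g \<longlongrightarrow> l) (at s within {0..1} \<inter> {..<s})"
      by (rule lim) (use t in auto)
    then show "\<exists>l. (g \<longlongrightarrow> l) (at s within {0..1} \<inter> {..<s})" ..
  qed
  then have "apply_cadlag (Cadlag g) = g"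
    by (intro Cadlag_inverse) (auto simp: g_def)
  then show ?thesis
    by (simp add: rescaled_path_def g_def)
qed

section \<open>Processes\<close>

text \<open>Processes are indexed by \<open>[0,\<infinity>)\<close>; their values at negative times are irrelevant.\<close>

definition (in prob_space) cadlag_process :: "(real \<Rightarrow> 'a \<Rightarrow> real) \<Rightarrow> bool" where
  "cadlag_process X \<longleftrightarrow>
    (\<forall>t\<ge>0. random_variable borel (X t)) \<and>
    (\<forall>\<omega>\<in>space M. cadlag_on {0..} (\<lambda>t. X t \<omega>))"

definition (in prob_space) independent_increments :: "(real \<Rightarrow> 'a \<Rightarrow> real) \<Rightarrow> bool" where
  "independent_increments X \<longleftrightarrow>
    (\<forall>(n::nat) (t::nat \<Rightarrow> real). 0 \<le> t 0 \<and> (\<forall>i<n. t i < t (Suc i)) \<longrightarrow>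
      indep_vars (\<lambda>_. borel) (\<lambda>i \<omega>. X (t (Suc i)) \<omega> - X (t i) \<omega>) {..<n})"

definition (in prob_space) additive_process :: "(real \<Rightarrow> 'a \<Rightarrow> real) \<Rightarrow> bool" where
  "additive_process X \<longleftrightarrow>
    cadlag_process X \<and> independent_increments X \<and> (\<forall>\<omega>\<in>space M. X 0 \<omega> = 0)"

section \<open>Large and moderate deviation principles\<close>

definition ereal_ln :: "real \<Rightarrow> ereal" where
  "ereal_ln p = (if p \<le> 0 then -\<infinity> else ereal (ln p))"

definition good_rate_function :: "('b::metric_space \<Rightarrow> ennreal) \<Rightarrow> bool" where
  "good_rate_function I \<longleftrightarrow> (\<forall>r\<ge>0. compact {f. I f \<le> ennreal r})"

definition (in prob_space) large_deviation_principle ::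
    "(real \<Rightarrow> 'a \<Rightarrow> 'b::metric_space) \<Rightarrow> ('b \<Rightarrow> ennreal) \<Rightarrow> (real \<Rightarrow> real) \<Rightarrow> bool" where
  "large_deviation_principle Y I a \<longleftrightarrow>
    (\<forall>t>0. random_variable borel (Y t)) \<and>
    good_rate_function I \<and>
    (\<forall>t>0. a t > 0) \<and> filterlim a at_top at_top \<and>
    (\<forall>U. open U \<longrightarrow>
      - enn2ereal (INF f\<in>U. I f)
        \<le> Liminf at_top (\<lambda>t. ereal (1 / a t) * ereal_ln (prob {\<omega>\<in>space M. Y t \<omega> \<in> U}))) \<and>
    (\<forall>F. closed F \<longrightarrow>
      Limsup at_top (\<lambda>t. ereal (1 / a t) * ereal_ln (prob {\<omega>\<in>space M. Y t \<omega> \<in> F}))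
        \<le> - enn2ereal (INF f\<in>F. I f))"

text \<open>
  Since \<open>x / 0 = 0\<close>, the requirement that \<open>S t / Var (X t)\<close> tends to \<open>0\<close> is accompanied by the
  condition that the quotient eventually makes sense.
\<close>

definition (in prob_space) moderate_deviation_principle ::
    "(real \<Rightarrow> 'a \<Rightarrow> real) \<Rightarrow> (real \<Rightarrow> real) \<Rightarrow> (cadlag \<Rightarrow> ennreal) \<Rightarrow> (real \<Rightarrow> real) \<Rightarrow> bool" where
  "moderate_deviation_principle X S I a \<longleftrightarrow>
    cadlag_process X \<and>
    (\<forall>t\<ge>0. integrable M (\<lambda>\<omega>. (X t \<omega>)\<^sup>2)) \<and>
    (\<forall>t>0. S t > 0) \<and>
    (\<forall>\<^sub>F t in at_top. variance (X t) > 0) \<and>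
    ((\<lambda>t. S t / variance (X t)) \<longlongrightarrow> 0) at_top \<and>
    large_deviation_principle (\<lambda>t \<omega>. (1 / S t) *\<^sub>R rescaled_path (\<lambda>u. X u \<omega>) t) I a"

section \<open>The rate function\<close>

definition absolutely_continuous_on :: "real \<Rightarrow> real \<Rightarrow> (real \<Rightarrow> real) \<Rightarrow> bool" where
  "absolutely_continuous_on a b f \<longleftrightarrow>
    (\<forall>\<epsilon>>0. \<exists>\<delta>>0. \<forall>(n::nat) u v.
      (\<forall>i<n. a \<le> u i \<and> u i < v i \<and> v i \<le> b) \<and>
      disjoint_family_on (\<lambda>i. {u i<..<v i}) {..<n} \<and>
      (\<Sum>i<n. v i - u i) < \<delta> \<longrightarrow>
      (\<Sum>i<n. \<bar>f (v i) - f (u i)\<bar>) < \<epsilon>)"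

text \<open>
  An absolutely continuous function is differentiable almost everywhere on \<open>(0,1)\<close>, so the
  unspecified values of \<open>deriv\<close> elsewhere do not affect the integral; nor does the point \<open>s = 0\<close>.
\<close>

definition rate_function :: "real \<Rightarrow> real \<Rightarrow> cadlag \<Rightarrow> ennreal" where
  "rate_function \<sigma> \<gamma> f =
    (if absolutely_continuous_on 0 1 (apply_cadlag f) \<and> apply_cadlag f 0 = 0
     then ennreal (1 / (2 * \<sigma>\<^sup>2 * \<gamma>)) *
       (\<integral>\<^sup>+ s \<in> {0..1}. ennreal ((deriv (apply_cadlag f) s)\<^sup>2 / s powr (\<gamma> - 1)) \<partial>lborel)
     else \<infinity>)"

section \<open>Limit points as time tends to infinity\<close>

text \<open>These two notions concern a family indexed by \<open>(0,\<infinity>)\<close>.\<close>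

definition relatively_compact_at_top :: "(real \<Rightarrow> 'b::topological_space) \<Rightarrow> bool" where
  "relatively_compact_at_top y \<longleftrightarrow>
    (\<forall>t :: nat \<Rightarrow> real. (\<forall>n. t n > 0) \<and> filterlim t at_top sequentially \<longrightarrow>
      (\<exists>r f. strict_mono r \<and> (\<lambda>n. y (t (r n))) \<longlonglongrightarrow> f))"

definition limit_points_at_top :: "(real \<Rightarrow> 'b::topological_space) \<Rightarrow> 'b set" where
  "limit_points_at_top y =
    {f. \<exists>t :: nat \<Rightarrow> real. (\<forall>n. t n > 0) \<and> filterlim t at_top sequentially \<and>
      (\<lambda>n. y (t n)) \<longlonglongrightarrow> f}"

end

theory Submission
  imports Defs "HOL-Real_Asymp.Real_Asymp"
begin

text \<open>
  Let \<open>K\<close> be the sublevel set and \<open>y t = X(t \<cdot>) / S(t)\<close>; the speed is \<open>2 log log t\<close>.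
  The upper bound of the deviation principle and the first Borel-Cantelli lemma along the geometric
  sequences \<open>(1 + 1/k)\<^sup>n\<close> show that \<open>y\<close> approaches \<open>K\<close> along them; since \<open>K\<close> is compact and consists of
  continuous functions, hence equicontinuous, the gaps can be filled and \<open>dist (y t, K) \<rightarrow> 0\<close>.

  Conversely let \<open>h\<close> have rate below \<open>1/2\<close>. On the grid of multiples of \<open>1/m\<close>, the increments of
  \<open>y (m\<^sup>n)\<close> over the cells other than the first one come from \<open>X\<close> on \<open>[m\<^sup>n\<^sup>-\<^sup>1, m\<^sup>n]\<close>, so they are
  independent for different \<open>n\<close>, and the lower bound together with the second Borel-Cantelli lemma makes
  them close to those of \<open>h\<close> infinitely often. As \<open>y (m\<^sup>n)\<close> is close to the equicontinuous set \<open>K\<close>, whose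
  elements vanish at \<open>0\<close>, closeness of grid increments already gives uniform closeness to \<open>h\<close>.

  Functions of rate below \<open>1/2\<close> are dense in \<open>K\<close>: the rate of \<open>c f\<close> is concave in \<open>c\<^sup>2\<close>,
  so if it did not drop below \<open>1/2\<close> for some \<open>c < 1\<close>, all larger multiples of \<open>f\<close> would lie in the
  bounded set \<open>K\<close>.
\<close>

section \<open>Lower integrals of possibly nonmeasurable functions\<close>

text \<open>
  For nonmeasurable functions \<open>nn_integral\<close> is a lower integral. Working with it directly avoids the
  measurability of \<open>deriv\<close> and of the set where a function is differentiable.
\<close>

lemma nn_integral_superadd:
  "(\<integral>\<^sup>+x. f x \<partial>M) + (\<integral>\<^sup>+x. g x \<partial>M) \<le> (\<integral>\<^sup>+x. f x + g x \<partial>M)"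
proof -
  let ?S = "\<lambda>f. {h. simple_function M h \<and> h \<le> f}"
  have ne: "?S f \<noteq> {}" for f :: "'a \<Rightarrow> ennreal"
    by (auto intro!: exI[of _ "\<lambda>_. 0"] simp: le_fun_def)
  have "integral\<^sup>S M a + integral\<^sup>S M b \<le> (\<integral>\<^sup>+x. f x + g x \<partial>M)"
    if "a \<in> ?S f" "b \<in> ?S g" for a b
  proof -
    have "integral\<^sup>S M a + integral\<^sup>S M b = (\<integral>\<^sup>Sx. a x + b x \<partial>M)"
      using that by (intro simple_integral_add[symmetric]) auto
    also have "\<dots> = (\<integral>\<^sup>+x. a x + b x \<partial>M)"
      using that by (intro nn_integral_eq_simple_integral[symmetric]) auto
    also have "\<dots> \<le> (\<integral>\<^sup>+x. f x + g x \<partial>M)"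
      using that by (intro nn_integral_mono add_mono) (auto simp: le_fun_def)
    finally show ?thesis .
  qed
  \<comment> \<open>The suprema over simple functions that define the two lower integrals are taken
    one after the other, first over those below \<open>g\<close>.\<close>
  then have "integral\<^sup>S M a + integral\<^sup>N M g \<le> (\<integral>\<^sup>+x. f x + g x \<partial>M)" if "a \<in> ?S f" for a
    unfolding nn_integral_def[of M g] ennreal_SUP_add_right[OF ne]
    using that by (intro SUP_least) auto
  then show ?thesis
    unfolding nn_integral_def[of M f] ennreal_SUP_add_left[OF ne, symmetric]
    by (intro SUP_least) auto
qed

lemma nn_integral_cmult_le: "c * (\<integral>\<^sup>+x. f x \<partial>M) \<le> (\<integral>\<^sup>+x. c * f x \<partial>M)"
  unfolding nn_integral_def[of M f] SUP_mult_left_ennreal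
proof (rule SUP_least)
  fix g assume g: "g \<in> {g. simple_function M g \<and> g \<le> f}"
  then have "c * integral\<^sup>S M g = (\<integral>\<^sup>+x. c * g x \<partial>M)"
    by (simp add: nn_integral_eq_simple_integral)
  also have "\<dots> \<le> (\<integral>\<^sup>+x. c * f x \<partial>M)"
    using g by (intro nn_integral_mono mult_left_mono) (auto simp: le_fun_def)
  finally show "c * integral\<^sup>S M g \<le> (\<integral>\<^sup>+x. c * f x \<partial>M)" .
qed

section \<open>Absolute continuity and scaling of the rate function\<close>

lemma absolutely_continuous_on_scale:
  assumes "absolutely_continuous_on a b f"
  shows "absolutely_continuous_on a b (\<lambda>x. c * f x)"
  unfolding absolutely_continuous_on_def
proof (intro allI impI)
  fix \<epsilon> :: real assume "\<epsilon> > 0"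
  then have "\<epsilon> / (\<bar>c\<bar> + 1) > 0" by simp
  with assms obtain \<delta> where \<delta>: "\<delta> > 0" and f:
    "\<And>(n::nat) u v. (\<forall>i<n. a \<le> u i \<and> u i < v i \<and> v i \<le> b) \<and>
      disjoint_family_on (\<lambda>i. {u i<..<v i}) {..<n} \<and> (\<Sum>i<n. v i - u i) < \<delta> \<Longrightarrow>
      (\<Sum>i<n. \<bar>f (v i) - f (u i)\<bar>) < \<epsilon> / (\<bar>c\<bar> + 1)"
    unfolding absolutely_continuous_on_def by meson
  have "(\<Sum>i<n. \<bar>c * f (v i) - c * f (u i)\<bar>) < \<epsilon>"
    if "(\<forall>i<n. a \<le> u i \<and> u i < v i \<and> v i \<le> b) \<and>
      disjoint_family_on (\<lambda>i. {u i<..<v i}) {..<n} \<and> (\<Sum>i<n. v i - u i) < \<delta>"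
    for n :: nat and u v
  proof -
    have "(\<Sum>i<n. \<bar>c * f (v i) - c * f (u i)\<bar>) = \<bar>c\<bar> * (\<Sum>i<n. \<bar>f (v i) - f (u i)\<bar>)"
      by (simp add: sum_distrib_left abs_mult flip: right_diff_distrib)
    also have "\<dots> \<le> (\<bar>c\<bar> + 1) * (\<Sum>i<n. \<bar>f (v i) - f (u i)\<bar>)"
      by (intro mult_right_mono sum_nonneg) auto
    also have "\<dots> < \<epsilon>"
      using f[OF that] by (simp add: field_simps)
    finally show ?thesis .
  qed
  with \<delta> show "\<exists>\<delta>>0. \<forall>(n::nat) u v. (\<forall>i<n. a \<le> u i \<and> u i < v i \<and> v i \<le> b) \<and>
      disjoint_family_on (\<lambda>i. {u i<..<v i}) {..<n} \<and> (\<Sum>i<n. v i - u i) < \<delta> \<longrightarrow>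
      (\<Sum>i<n. \<bar>c * f (v i) - c * f (u i)\<bar>) < \<epsilon>"
    by blast
qed

lemma absolutely_continuous_on_imp_continuous_on:
  assumes "absolutely_continuous_on a b f"
  shows "continuous_on {a..b} f"
  unfolding continuous_on_iff
proof (intro ballI allI impI)
  fix x e :: real assume x: "x \<in> {a..b}" and e: "0 < e"
  from assms e obtain \<delta> where \<delta>: "\<delta> > 0" and f:
    "\<And>(n::nat) u v. (\<forall>i<n. a \<le> u i \<and> u i < v i \<and> v i \<le> b) \<and>
      disjoint_family_on (\<lambda>i. {u i<..<v i}) {..<n} \<and> (\<Sum>i<n. v i - u i) < \<delta> \<Longrightarrow>
      (\<Sum>i<n. \<bar>f (v i) - f (u i)\<bar>) < e"
    unfolding absolutely_continuous_on_def by meson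
  have *: "\<bar>f v - f u\<bar> < e" if "a \<le> u" "u < v" "v \<le> b" "v - u < \<delta>" for u v
    using f[of 1 "\<lambda>_. u" "\<lambda>_. v"] that by (simp add: disjoint_family_on_def)
  have "dist (f y) (f x) < e" if "y \<in> {a..b}" "dist y x < \<delta>" for y
    using *[of x y] *[of y x] that x e
    by (cases x y rule: linorder_cases) (auto simp: dist_real_def)
  with \<delta> show "\<exists>d>0. \<forall>y\<in>{a..b}. dist y x < d \<longrightarrow> dist (f y) (f x) < e"
    by blast
qed

text \<open>Multiplying by a nonzero constant leaves the unspecified value of \<open>deriv\<close> unchanged.\<close>

lemma deriv_scale:
  fixes f :: "real \<Rightarrow> real"
  assumes "c \<noteq> 0"
  shows "deriv (\<lambda>x. c * f x) x = (if f field_differentiable at x then c else 1) * deriv f x"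
proof (cases "f field_differentiable at x")
  case True
  then show ?thesis by simp
next
  case False
  have "\<not> (\<lambda>x. c * f x) field_differentiable at x"
  proof
    assume "(\<lambda>x. c * f x) field_differentiable at x"
    then have "(\<lambda>x. inverse c * (c * f x)) field_differentiable at x"
      by (rule field_differentiable_mult[OF field_differentiable_const])
    moreover have "(\<lambda>x. inverse c * (c * f x)) = f"
      using assms by auto
    ultimately show False using False by simp
  qed
  \<comment> \<open>Neither function has a derivative at \<open>x\<close>, so the choice operator in
    \<open>deriv\<close> is applied to the same, everywhere false predicate and returns the same
    value twice.\<close>
  with False have "\<not> DERIV f x :> D" "\<not> DERIV (\<lambda>x. c * f x) x :> D" for D
    by (auto simp: field_differentiable_def)
  with False show ?thesis by (simp add: deriv_def)
qed

lemma rate_function_0: "rate_function \<sigma> \<gamma> 0 = 0"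
  by (auto simp: rate_function_def zero_cadlag.rep_eq absolutely_continuous_on_def
      intro: exI[of _ 1])

lemma rate_function_finite:
  assumes "rate_function \<sigma> \<gamma> f < \<infinity>"
  shows "absolutely_continuous_on 0 1 (apply_cadlag f)" "apply_cadlag f 0 = 0"
  using assms by (auto simp: rate_function_def split: if_splits)

text \<open>Pointwise, scaling by \<open>c\<close> multiplies the integrand by \<open>c^2\<close>
  where the function is differentiable and leaves it unchanged elsewhere. Both factors are affine in
  \<open>c^2\<close>, so the integrands combine exactly. The lower integral is only shown to be
  superadditive and superhomogeneous, which yields an inequality in this direction.\<close>

lemma rate_function_scale_concave:
  assumes fin: "rate_function \<sigma> \<gamma> f < \<infinity>" and "0 < a" "0 < b" "0 \<le> l" "l \<le> 1"
    and l: "l * a\<^sup>2 + (1 - l) * b\<^sup>2 = 1"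
  shows "ennreal l * rate_function \<sigma> \<gamma> (a *\<^sub>R f) + ennreal (1 - l) * rate_function \<sigma> \<gamma> (b *\<^sub>R f)
    \<le> rate_function \<sigma> \<gamma> f"
proof -
  note f = rate_function_finite[OF fin]
  define g where "g = apply_cadlag f"
  define k where "k c s = ennreal ((deriv (\<lambda>x. c * g x) s)\<^sup>2 / s powr (\<gamma> - 1)) * indicator {0..1} s"
    for c s :: real
  define C where "C = ennreal (1 / (2 * \<sigma>\<^sup>2 * \<gamma>))"
  have I: "rate_function \<sigma> \<gamma> (c *\<^sub>R f) = C * (\<integral>\<^sup>+s. k c s \<partial>lborel)" for c
    using f absolutely_continuous_on_scale[OF f(1), of c]
    by (simp add: rate_function_def scaleR_cadlag.rep_eq k_def C_def g_def)
  have k: "ennreal l * k a s + ennreal (1 - l) * k b s = k 1 s" for s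
  proof -
    define p where "p = (deriv g s)\<^sup>2 / s powr (\<gamma> - 1)"
    have p: "p \<ge> 0" by (simp add: p_def)
    \<comment> \<open>The factor by which the integrand at \<open>s\<close> changes under scaling by
      \<open>c\<close>.\<close>
    define z where "z c = (if g field_differentiable at s then c\<^sup>2 else 1)" for c :: real
    have z: "z c \<ge> 0" for c by (simp add: z_def)
    have kz: "k c s = ennreal (z c * p) * indicator {0..1} s" if "c \<noteq> 0" for c
      unfolding k_def deriv_scale[OF that] by (simp add: z_def p_def power_mult_distrib)
    have "l * z a + (1 - l) * z b = z 1"
      using l by (auto simp: z_def)
    from arg_cong[OF this, of "\<lambda>y. y * p"]
    have "l * (z a * p) + (1 - l) * (z b * p) = z 1 * p"
      by (simp add: distrib_right mult.assoc)
    then have "ennreal l * ennreal (z a * p) + ennreal (1 - l) * ennreal (z b * p) = ennreal (z 1 * p)"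
      using p z assms by (simp flip: ennreal_mult ennreal_plus)
    then show ?thesis
      using assms kz[of a] kz[of b] kz[of 1] by (auto simp: indicator_def)
  qed
  have "ennreal l * (\<integral>\<^sup>+s. k a s \<partial>lborel) + ennreal (1 - l) * (\<integral>\<^sup>+s. k b s \<partial>lborel)
      \<le> (\<integral>\<^sup>+s. ennreal l * k a s \<partial>lborel) + (\<integral>\<^sup>+s. ennreal (1 - l) * k b s \<partial>lborel)"
    by (intro add_mono nn_integral_cmult_le)
  also have "\<dots> \<le> (\<integral>\<^sup>+s. k 1 s \<partial>lborel)"
    using nn_integral_superadd[of lborel "\<lambda>s. ennreal l * k a s" "\<lambda>s. ennreal (1 - l) * k b s"]
    by (simp add: k)
  finally have "C * (ennreal l * (\<integral>\<^sup>+s. k a s \<partial>lborel) + ennreal (1 - l) * (\<integral>\<^sup>+s. k b s \<partial>lborel))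
      \<le> C * (\<integral>\<^sup>+s. k 1 s \<partial>lborel)"
    by (rule mult_left_mono) simp
  moreover have "rate_function \<sigma> \<gamma> f = C * (\<integral>\<^sup>+s. k 1 s \<partial>lborel)"
    using I[of 1] by simp
  ultimately show ?thesis
    by (simp add: I algebra_simps)
qed

text \<open>If the rate at \<open>a *\<^sub>R f\<close> were still at least \<open>r\<close>,
  concavity would keep it at most \<open>r\<close> at \<open>b *\<^sub>R f\<close> for every
  \<open>b > 1\<close>, and a bounded set cannot contain all these multiples of a nonzero
  \<open>f\<close>. This stands in for the quadratic homogeneity of the rate.\<close>

lemma rate_function_scale_less:
  assumes "bounded {g. rate_function \<sigma> \<gamma> g \<le> ennreal r}" and "r > 0"
    and f: "rate_function \<sigma> \<gamma> f \<le> ennreal r" and a: "0 < a" "a < 1"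
  shows "rate_function \<sigma> \<gamma> (a *\<^sub>R f) < ennreal r"
proof (cases "f = 0")
  case True
  with assms show ?thesis by (simp add: rate_function_0)
next
  case False
  show ?thesis
  proof (rule ccontr)
    assume "\<not> ?thesis"
    then have ge: "ennreal r \<le> rate_function \<sigma> \<gamma> (a *\<^sub>R f)" by simp
    obtain B where B: "\<And>g. rate_function \<sigma> \<gamma> g \<le> ennreal r \<Longrightarrow> norm g \<le> B"
      using assms(1) unfolding bounded_iff by blast
    have "rate_function \<sigma> \<gamma> (b *\<^sub>R f) \<le> ennreal r" if b: "b > 1" for b
    proof -
      \<comment> \<open>The weight that represents 1 as a convex combination of the squares of
        \<open>a\<close> and \<open>b\<close>.\<close>
      define l where "l = (b\<^sup>2 - 1) / (b\<^sup>2 - a\<^sup>2)"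
      have "a\<^sup>2 < 1" "1 < b\<^sup>2"
        using a b by (auto simp: power_less_one_iff)
      then have l: "0 \<le> l" "l < 1" and "l * (b\<^sup>2 - a\<^sup>2) = b\<^sup>2 - 1"
        by (auto simp: l_def)
      then have "l * a\<^sup>2 + (1 - l) * b\<^sup>2 = 1"
        by (simp add: algebra_simps)
      have "rate_function \<sigma> \<gamma> f < \<infinity>"
        using f by (simp add: order_le_less_trans)
      then have "ennreal l * rate_function \<sigma> \<gamma> (a *\<^sub>R f) + ennreal (1 - l) * rate_function \<sigma> \<gamma> (b *\<^sub>R f)
          \<le> rate_function \<sigma> \<gamma> f"
        using a b l by (intro rate_function_scale_concave) (auto simp: \<open>l * a\<^sup>2 + (1 - l) * b\<^sup>2 = 1\<close>)
      moreover have "ennreal l * ennreal r \<le> ennreal l * rate_function \<sigma> \<gamma> (a *\<^sub>R f)"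
        using ge by (intro mult_left_mono) auto
      ultimately have le: "ennreal l * ennreal r + ennreal (1 - l) * rate_function \<sigma> \<gamma> (b *\<^sub>R f) \<le> ennreal r"
        using f by (meson add_mono dual_order.refl order_trans)
      \<comment> \<open>As \<open>1 - l > 0\<close>, an infinite rate would make the left side of
        \<open>le\<close> infinite. Finiteness allows the comparison to continue in the
        reals.\<close>
      have "rate_function \<sigma> \<gamma> (b *\<^sub>R f) \<noteq> \<infinity>"
        using le l by (auto simp: ennreal_mult_top top_unique)
      then obtain x where x: "rate_function \<sigma> \<gamma> (b *\<^sub>R f) = ennreal x" "x \<ge> 0"
        by (cases "rate_function \<sigma> \<gamma> (b *\<^sub>R f)") auto
      from le have "l * r + (1 - l) * x \<le> r"
        using x l \<open>r > 0\<close> by (simp flip: ennreal_mult ennreal_plus)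
      then have "(1 - l) * x \<le> (1 - l) * r" by (simp add: algebra_simps)
      with l x show ?thesis by (auto intro: ennreal_leI)
    qed
    then have "b * norm f \<le> B" if "b > 1" for b
      using B[of "b *\<^sub>R f"] that by auto
    \<comment> \<open>This multiple has norm at least \<open>B + 1\<close>; the 2 ensures a factor
      above 1.\<close>
    from this[of "max 2 ((B + 1) / norm f)"] have "max 2 ((B + 1) / norm f) * norm f \<le> B" by simp
    moreover have "(B + 1) / norm f * norm f \<le> max 2 ((B + 1) / norm f) * norm f"
      by (intro mult_right_mono) auto
    ultimately show False using False by simp
  qed
qed

section \<open>Countable dense subsets and equicontinuity for compact sets\<close>

text \<open>For each radius 1/(k+1) finitely many balls with centres in \<open>A\<close> cover
  \<open>K\<close>; all their centres together form \<open>D\<close>. Countability later permits one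
  null set for all approximating functions.\<close>

lemma compact_dense_subset_countable:
  fixes K :: "'a::metric_space set"
  assumes "compact K" and dense: "\<And>x e. x \<in> K \<Longrightarrow> e > 0 \<Longrightarrow> \<exists>y\<in>A. dist y x < e"
  shows "\<exists>D. countable D \<and> D \<subseteq> A \<and> (\<forall>x\<in>K. \<forall>e>0. \<exists>y\<in>D. dist y x < e)"
proof -
  have "\<exists>N. N \<subseteq> A \<and> finite N \<and> K \<subseteq> (\<Union>y\<in>N. ball y (inverse (real (Suc k))))" for k
  proof (rule compactE_image[OF \<open>compact K\<close>, of A "\<lambda>y. ball y (inverse (real (Suc k)))"])
    show "K \<subseteq> (\<Union>y\<in>A. ball y (inverse (real (Suc k))))"
      using dense[of _ "inverse (real (Suc k))"] by fastforce
  qed auto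
  then obtain N where N: "\<And>k. N k \<subseteq> A" "\<And>k. finite (N k)"
    "\<And>k. K \<subseteq> (\<Union>y\<in>N k. ball y (inverse (real (Suc k))))" by metis
  have "\<exists>y\<in>(\<Union>k. N k). dist y x < e" if x: "x \<in> K" and e: "e > 0" for x e
  proof -
    obtain k where "inverse (real (Suc k)) < e" using reals_Archimedean[OF e] by blast
    moreover obtain y where "y \<in> N k" "dist y x < inverse (real (Suc k))"
      using N(3)[of k] x by auto
    ultimately show ?thesis by force
  qed
  moreover have "countable (\<Union>k. N k)"
    using N(2) by (simp add: countable_finite)
  ultimately show ?thesis
    using N(1) by (intro exI[of _ "\<Union>k. N k"]) blast
qed

text \<open>The easy half of Arzela-Ascoli: the members of a finite \<open>e / 3\<close>-net are
  uniformly continuous, and the smallest of their moduli serves all of \<open>K\<close>.\<close>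

lemma compact_cadlag_equicontinuous:
  assumes "compact K" and cont: "\<And>g. g \<in> K \<Longrightarrow> continuous_on {0..1} (apply_cadlag g)" and "e > 0"
  shows "\<exists>d>0. \<forall>g\<in>K. \<forall>u\<in>{0..1}. \<forall>v\<in>{0..1}.
    \<bar>u - v\<bar> < d \<longrightarrow> \<bar>apply_cadlag g u - apply_cadlag g v\<bar> < e"
proof -
  have "e / 3 > 0" using \<open>e > 0\<close> by simp
  obtain N where N: "N \<subseteq> K" "finite N" "K \<subseteq> (\<Union>y\<in>N. ball y (e / 3))"
    by (rule compactE_image[OF \<open>compact K\<close>, of K "\<lambda>y. ball y (e / 3)"]) (use \<open>e > 0\<close> in auto)
  have "\<exists>d>0. \<forall>u\<in>{0..1}. \<forall>v\<in>{0..1}. \<bar>u - v\<bar> < d \<longrightarrow> \<bar>apply_cadlag g u - apply_cadlag g v\<bar> < e / 3"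
    if "g \<in> N" for g
    using compact_uniformly_continuous[OF cont[of g]] that N \<open>e / 3 > 0\<close>
    unfolding uniformly_continuous_on_def dist_real_def
    by (metis compact_Icc subsetD abs_minus_commute)
  then obtain d where d: "\<And>g. g \<in> N \<Longrightarrow> d g > 0"
    "\<And>g u v. g \<in> N \<Longrightarrow> u \<in> {0..1} \<Longrightarrow> v \<in> {0..1} \<Longrightarrow> \<bar>u - v\<bar> < d g \<Longrightarrow>
      \<bar>apply_cadlag g u - apply_cadlag g v\<bar> < e / 3"
    by metis
  \<comment> \<open>The inserted 1 gives \<open>Min\<close> a nonempty set even when
    \<open>N\<close> is empty.\<close>
  define d0 where "d0 = Min (insert 1 (d ` N))"
  have "d0 > 0" using N(2) d(1) by (auto simp: d0_def)
  moreover have "\<bar>apply_cadlag h u - apply_cadlag h v\<bar> < e"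
    if h: "h \<in> K" and uv: "u \<in> {0..1}" "v \<in> {0..1}" "\<bar>u - v\<bar> < d0" for h u v
  proof -
    obtain g where g: "g \<in> N" "norm (g - h) < e / 3"
      using N(3) h by (auto simp: dist_norm)
    have "d0 \<le> d g" using g N(2) by (simp add: d0_def)
    then have "\<bar>apply_cadlag g u - apply_cadlag g v\<bar> < e / 3"
      using d(2) g uv by auto
    moreover have "\<bar>apply_cadlag g s - apply_cadlag h s\<bar> < e / 3" if "s \<in> {0..1}" for s
      using abs_apply_cadlag_le_norm[OF that, of "g - h"] g by (simp add: minus_cadlag.rep_eq)
    from this[of u] this[of v] uv have "\<bar>apply_cadlag g u - apply_cadlag h u\<bar> < e / 3"
      "\<bar>apply_cadlag g v - apply_cadlag h v\<bar> < e / 3" by auto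
    ultimately show ?thesis by linarith
  qed
  ultimately show ?thesis by blast
qed

section \<open>The second Borel-Cantelli lemma\<close>

text \<open>By independence and 1 - x \<le> exp(-x), the probability that none of
  \<open>A N\<close>, ..., \<open>A (N + k)\<close> occurs is at most the exponential of minus a
  partial sum. The partial sums are unbounded, so from no \<open>N\<close> on can the events all
  fail with positive probability.\<close>

lemma (in prob_space) borel_cantelli_AE2:
  assumes ind: "indep_events A UNIV" and sum: "\<not> summable (\<lambda>n::nat. prob (A n))"
  shows "AE \<omega> in M. \<exists>\<^sub>\<infinity>n. \<omega> \<in> A n"
proof -
  have ev[measurable]: "A n \<in> events" for n using ind by (auto simp: indep_events_def)
  define C where "C n = space M - A n" for n
  have [measurable]: "C n \<in> events" for n by (simp add: C_def)
  \<comment> \<open>Passing to the generated sigma algebras makes the complements \<open>C i\<close>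
    independent as well.\<close>
  have ind': "indep_sets (\<lambda>i. sigma_sets (space M) {A i}) UNIV"
    using ind unfolding indep_events_def_alt
    by (intro indep_sets_sigma) (auto simp: Int_stable_def)
  have prod: "prob (\<Inter>i\<in>{N..N+k}. C i) = (\<Prod>i\<in>{N..N+k}. prob (C i))" for N k
    by (intro indep_setsD[OF ind']) (auto simp: C_def intro: sigma_sets.intros)
  have "prob (\<Inter>i\<in>{N..}. C i) = 0" for N
  proof -
    have bound: "prob (\<Inter>i\<in>{N..}. C i) \<le> exp (- (\<Sum>i\<le>k. prob (A (i + N))))" for k
    proof -
      have "(\<Inter>i\<in>{N..N+k}. C i) \<in> events" by (intro sets.finite_INT) auto
      then have "prob (\<Inter>i\<in>{N..}. C i) \<le> prob (\<Inter>i\<in>{N..N+k}. C i)"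
        by (intro finite_measure_mono) auto
      also have "\<dots> = (\<Prod>i\<in>{N..N+k}. 1 - prob (A i))"
        unfolding prod by (intro prod.cong refl) (simp add: C_def prob_compl)
      also have "\<dots> \<le> (\<Prod>i\<in>{N..N+k}. exp (- prob (A i)))"
        by (intro prod_mono) (auto intro: exp_ge_add_one_self[of "- x" for x, simplified])
      also have "\<dots> = exp (- (\<Sum>i\<in>{N..N+k}. prob (A i)))"
        by (simp add: exp_sum sum_negf[symmetric])
      also have "(\<Sum>i\<in>{N..N+k}. prob (A i)) = (\<Sum>i\<le>k. prob (A (i + N)))"
        using sum.shift_bounds_cl_nat_ivl[of "\<lambda>i. prob (A i)" 0 N k]
        by (simp add: atLeast0AtMost add.commute)
      finally show ?thesis .
    qed
    have "\<not> summable (\<lambda>i. prob (A (i + N)))"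
      using sum summable_iff_shift[of "\<lambda>i. prob (A i)" N] by simp
    then have unb: "\<exists>k. B < (\<Sum>i\<le>k. prob (A (i + N)))" for B
      using bounded_imp_summable[of "\<lambda>i. prob (A (i + N))" B] by (meson measure_nonneg not_le)
    show ?thesis
    proof (rule ccontr)
      assume "prob (\<Inter>i\<in>{N..}. C i) \<noteq> 0"
      then have p: "prob (\<Inter>i\<in>{N..}. C i) > 0" by (simp add: zero_less_measure_iff)
      obtain k where "- ln (prob (\<Inter>i\<in>{N..}. C i)) < (\<Sum>i\<le>k. prob (A (i + N)))"
        using unb by blast
      then have "exp (- (\<Sum>i\<le>k. prob (A (i + N)))) < exp (ln (prob (\<Inter>i\<in>{N..}. C i)))"
        by simp
      with bound[of k] p show False by simp
    qed
  qed
  then have "(\<Inter>i\<in>{N..}. C i) \<in> null_sets M" for N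
    by (intro null_setsI) (auto simp: emeasure_eq_measure)
  then have "AE \<omega> in M. \<forall>N. \<omega> \<notin> (\<Inter>i\<in>{N..}. C i)"
    unfolding AE_all_countable by (blast intro: AE_not_in)
  then show ?thesis
    by (rule AE_mp) (auto simp: C_def INFM_nat_le intro!: AE_I2)
qed

section \<open>The normalising function of the law of the iterated logarithm\<close>

definition lil_scale :: "real \<Rightarrow> real \<Rightarrow> real" where
  "lil_scale \<gamma> t = sqrt (2 * t powr \<gamma> * ln (ln (max t (exp (exp 1)))))"

text \<open>The effect of the truncation at \<open>exp (exp 1)\<close>: both logarithms stay
  positive, so positivity of the scale and of the speed holds at every positive time and not only
  eventually.\<close>

lemma one_le_lnln_max:
  fixes t :: real
  shows "1 \<le> ln (ln (max t (exp (exp 1)))) \<and> 1 < ln (max t (exp (exp 1)))"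
proof -
  have "exp (exp 1) \<le> max t (exp (exp (1::real)))" by simp
  then have "exp 1 \<le> ln (max t (exp (exp (1::real))))" by (intro ln_ge_iff[THEN iffD2]) (simp_all add: less_max_iff_disj)
  moreover from this have "1 < ln (max t (exp (exp 1)))"
    using less_le_trans[of 1 "exp (1::real)"] by simp
  ultimately show ?thesis by (auto intro: ln_ge_iff[THEN iffD2])
qed

lemma lil_scale_pos: "t > 0 \<Longrightarrow> lil_scale \<gamma> t > 0"
  using one_le_lnln_max[of t] by (simp add: lil_scale_def)

lemma lil_scale_mono:
  assumes "0 < s" "s \<le> t" "\<gamma> \<ge> 0"
  shows "lil_scale \<gamma> s \<le> lil_scale \<gamma> t"
proof -
  have "ln (max s (exp (exp 1))) \<le> ln (max t (exp (exp 1)))"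
    using assms by (intro ln_mono) (auto simp: max_def)
  then have "ln (ln (max s (exp (exp 1)))) \<le> ln (ln (max t (exp (exp 1))))"
    using one_le_lnln_max[of s] by (intro ln_mono[of "ln _"]) auto
  then show ?thesis
    using assms one_le_lnln_max[of s] unfolding lil_scale_def
    by (intro real_sqrt_le_mono mult_mono powr_mono2) auto
qed

lemma lil_speed:
  assumes "t > 0"
  shows "(lil_scale \<gamma> t)\<^sup>2 / t powr \<gamma> = 2 * ln (ln (max t (exp (exp 1))))"
  using assms one_le_lnln_max[of t] by (simp add: lil_scale_def)

text \<open>Since ln(c^n) = n ln c, the iterated logarithms of consecutive terms have ratio tending
  to 1. Only the power of \<open>c\<close> survives, and the square root halves its
  exponent.\<close>

lemma lil_scale_ratio:
  assumes "c > 1" "\<gamma> > 0"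
  shows "(\<lambda>n. lil_scale \<gamma> (c ^ Suc n) / lil_scale \<gamma> (c ^ n)) \<longlonglongrightarrow> c powr (\<gamma> / 2)"
proof -
  define L where "L n = 2 * (c ^ n) powr \<gamma> * ln (ln (c ^ n))" for n :: nat
  have ev: "eventually (\<lambda>n. c ^ n > exp (exp 1)) sequentially"
    using assms by (intro filterlim_at_top_dense[THEN iffD1, rule_format]) real_asymp
  have "(\<lambda>n. c powr \<gamma> * (ln ((real n + 1) * ln c) / ln (real n * ln c))) \<longlonglongrightarrow> c powr \<gamma> * 1"
    using assms by (intro tendsto_mult tendsto_const) real_asymp
  moreover have "eventually (\<lambda>n. c powr \<gamma> * (ln ((real n + 1) * ln c) / ln (real n * ln c)) =
     L (Suc n) / L n) sequentially"
    using eventually_gt_at_top[of 0]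
  proof eventually_elim
    case (elim n)
    have "ln (c ^ n) = real n * ln c" "ln (c ^ Suc n) = (real n + 1) * ln c"
      using assms by (simp_all only: ln_realpow of_nat_Suc) simp_all
    moreover have "(c ^ Suc n) powr \<gamma> = c powr \<gamma> * (c ^ n) powr \<gamma>"
      using assms by (simp add: powr_mult)
    moreover have "(c ^ n) powr \<gamma> > 0" using assms by simp
    ultimately show ?case
      by (simp only: L_def) simp
  qed
  moreover have lil: "lil_scale \<gamma> (c ^ n) = sqrt (L n)" if "exp (exp 1) < c ^ n" for n
    using that by (simp add: L_def lil_scale_def max_absorb1)
  ultimately have "(\<lambda>n. L (Suc n) / L n) \<longlonglongrightarrow> c powr \<gamma>"
    by (auto intro: Lim_transform_eventually)
  then have "(\<lambda>n. sqrt (L (Suc n) / L n)) \<longlonglongrightarrow> sqrt (c powr \<gamma>)"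
    by (rule tendsto_real_sqrt)
  moreover have "eventually (\<lambda>n. sqrt (L (Suc n) / L n) =
      lil_scale \<gamma> (c ^ Suc n) / lil_scale \<gamma> (c ^ n)) sequentially"
    using ev eventually_all_ge_at_top[OF ev]
  proof eventually_elim
    case (elim n)
    then have "c ^ Suc n > exp (exp 1)" by (meson le_add1 le_add_same_cancel1 lessI less_imp_le_nat)
    with elim show ?case
      by (simp only: lil real_sqrt_divide)
  qed
  moreover have "sqrt (c powr \<gamma>) = c powr (\<gamma> / 2)"
    using assms by (simp add: powr_half_sqrt[symmetric] powr_powr)
  ultimately show ?thesis
    by (auto intro: Lim_transform_eventually)
qed

section \<open>From geometric sequences of times to all times\<close>

text \<open>A statement about a single path. For \<open>t\<close> between consecutive powers of
  \<open>c\<close> the rescaled path at \<open>t\<close> is an initial piece of the one at the next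
  power \<open>u\<close>, stretched in time by \<open>l = t / u\<close> and in space by
  \<open>R = lil_scale \<gamma> u / lil_scale \<gamma> t\<close>. For \<open>c\<close> close to 1
  both factors are close to 1, and boundedness and equicontinuity of \<open>K\<close> bound the
  resulting change of a nearby \<open>g\<close> in \<open>K\<close>.\<close>

lemma infdist_lil_path_tendsto_0:
  assumes x: "cadlag_on {0..} x" and "\<gamma> > 0" and K: "compact K" "K \<noteq> {}"
    and cont: "\<And>g. g \<in> K \<Longrightarrow> continuous_on {0..1} (apply_cadlag g)"
    and y: "y = (\<lambda>t. (1 / lil_scale \<gamma> t) *\<^sub>R rescaled_path x t)"
    and lim: "\<And>k. (\<lambda>n. infdist (y ((1 + 1 / real (Suc k)) ^ n)) K) \<longlonglongrightarrow> 0"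
  shows "((\<lambda>t. infdist (y t) K) \<longlongrightarrow> 0) at_top"
proof (rule tendstoI)
  fix e :: real assume e: "e > 0"
  obtain B where B: "\<And>g. g \<in> K \<Longrightarrow> norm g \<le> B" "B > 0"
    using compact_imp_bounded[OF K(1)] unfolding bounded_pos by blast
  obtain d where d: "d > 0" and equi: "\<And>g u v. g \<in> K \<Longrightarrow> u \<in> {0..1} \<Longrightarrow> v \<in> {0..1} \<Longrightarrow>
      \<bar>u - v\<bar> < d \<Longrightarrow> \<bar>apply_cadlag g u - apply_cadlag g v\<bar> < e / 8"
    using compact_cadlag_equicontinuous[OF K(1) cont, of "e / 8"] e by (metis zero_less_divide_iff zero_less_numeral)
  \<comment> \<open>An upper bound for \<open>R\<close>: \<open>q \<le> 2\<close> at most doubles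
    the error of \<open>y u\<close>, and \<open>(q - 1) * B \<le> e / 8\<close> controls the
    stretching of \<open>g\<close>.\<close>
  define q where "q = 1 + min 1 (e / (8 * B))"
  have q: "q > 1" "q \<le> 2" "(q - 1) * B \<le> e / 8"
    using e B(2) by (auto simp: q_def min_def field_simps)
  have "((\<lambda>k. (1 + 1 / real (Suc k)) powr (\<gamma> / 2)) \<longlonglongrightarrow> 1)"
    by real_asymp
  then have "eventually (\<lambda>k. (1 + 1 / real (Suc k)) powr (\<gamma> / 2) < q) sequentially"
    using q by (intro order_tendstoD) auto
  moreover have "(\<lambda>k. 1 / real (Suc k)) \<longlonglongrightarrow> 0" by real_asymp
  then have "eventually (\<lambda>k. 1 / real (Suc k) < d) sequentially"
    using d by (intro order_tendstoD) auto
  ultimately have "eventually (\<lambda>k. (1 + 1 / real (Suc k)) powr (\<gamma> / 2) < q \<and> 1 / real (Suc k) < d) sequentially"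
    by eventually_elim auto
  then obtain k where k: "(1 + 1 / real (Suc k)) powr (\<gamma> / 2) < q" "1 / real (Suc k) < d"
    unfolding eventually_sequentially by blast
  define c where "c = 1 + 1 / real (Suc k)"
  have c: "c > 1" "c - 1 < d" "c powr (\<gamma> / 2) < q"
    using k by (auto simp: c_def)
  have "eventually (\<lambda>n. infdist (y (c ^ Suc n)) K < e / 8) sequentially"
    using lim[of k, THEN LIMSEQ_Suc] e by (intro order_tendstoD) (auto simp: c_def)
  moreover have "eventually (\<lambda>n. lil_scale \<gamma> (c ^ Suc n) / lil_scale \<gamma> (c ^ n) < q) sequentially"
    using lil_scale_ratio[OF c(1) \<open>\<gamma> > 0\<close>] c(3) by (rule order_tendstoD)
  ultimately have "eventually (\<lambda>n. infdist (y (c ^ Suc n)) K < e / 8 \<and>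
      lil_scale \<gamma> (c ^ Suc n) / lil_scale \<gamma> (c ^ n) < q) sequentially"
    by eventually_elim auto
  then obtain N where N: "\<And>n. n \<ge> N \<Longrightarrow> infdist (y (c ^ Suc n)) K < e / 8"
      "\<And>n. n \<ge> N \<Longrightarrow> lil_scale \<gamma> (c ^ Suc n) / lil_scale \<gamma> (c ^ n) < q"
    unfolding eventually_sequentially by blast
  have "infdist (y t) K < e" if t: "t \<ge> c ^ N" for t
  proof -
    have "c ^ N > 0" using c by simp
    with t have "t > 0" by linarith
    obtain n0 where "t < c ^ n0" using c(1) real_arch_pow by blast
    \<comment> \<open>The first power beyond \<open>t\<close>; its predecessor is at most
      \<open>t\<close>, which puts \<open>t\<close> into \<open>[c ^ n, c ^ Suc n)\<close>.\<close>
    define n1 where "n1 = (LEAST n. t < c ^ n)"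
    have n1: "t < c ^ n1" unfolding n1_def by (rule LeastI[of _ n0]) fact
    have "n1 > N"
    proof (rule ccontr)
      assume "\<not> ?thesis"
      then have "c ^ n1 \<le> c ^ N" using c by (intro power_increasing) auto
      with n1 t show False by linarith
    qed
    then obtain n where n: "n1 = Suc n" "n \<ge> N" by (cases n1) auto
    have "\<not> t < c ^ n" using n(1) not_less_Least[of n "\<lambda>n. t < c ^ n"] unfolding n1_def by auto
    then have cn: "c ^ n \<le> t" "t < c ^ Suc n" using n1 n by auto
    define u where "u = c ^ Suc n"
    have "c ^ n > 0" "u > 0" using c by (auto simp: u_def)
    note pos = this lil_scale_pos[OF \<open>t > 0\<close>, of \<gamma>] lil_scale_pos[OF \<open>u > 0\<close>, of \<gamma>]
      lil_scale_pos[OF \<open>c ^ n > 0\<close>, of \<gamma>]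
    define l where "l = t / u"
    \<comment> \<open>The time distortion satisfies 1 - l \<le> 1 - 1/c \<le> c - 1 < d, within
      reach of the modulus \<open>d\<close>.\<close>
    have "t * c \<ge> u" using cn c by (simp add: u_def mult.commute)
    then have "1 - l \<le> 1 - 1 / c" using pos c by (simp add: l_def field_simps)
    also have "\<dots> \<le> c - 1" using divide_left_mono[of 1 c "c - 1"] c by (simp add: diff_divide_distrib)
    finally have l: "0 \<le> l" "l \<le> 1" "1 - l < d" using c cn pos \<open>t > 0\<close> by (auto simp: l_def u_def)
    define R where "R = lil_scale \<gamma> u / lil_scale \<gamma> t"
    have "R \<ge> 1"
      using lil_scale_mono[of t u \<gamma>] cn \<open>t > 0\<close> \<open>\<gamma> > 0\<close> pos by (simp add: R_def u_def)
    have "R \<le> lil_scale \<gamma> u / lil_scale \<gamma> (c ^ n)"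
      using lil_scale_mono[of "c ^ n" t \<gamma>] cn \<open>\<gamma> > 0\<close> pos unfolding R_def
      by (intro divide_left_mono) auto
    also have "\<dots> < q" using N(2)[OF n(2)] by (simp add: u_def)
    finally have "R < q" .
    have "(INF g\<in>K. dist (y u) g) < e / 8"
      using N(1)[OF n(2)] K(2) by (simp add: u_def infdist_def)
    then obtain g where g: "g \<in> K" and yg: "norm (y u - g) < e / 8"
      using cInf_lessD[of "dist (y u) ` K" "e / 8"] K(2) by (auto simp: dist_norm)
    have "norm (y t - g) \<le> e / 2"
    proof (rule norm_cadlag_le)
      fix s :: real assume s: "s \<in> {0..1}"
      have ls: "l * s \<in> {0..1}" using l s by (auto intro: mult_le_one)
      have "x (u * (l * s)) = x (t * s)" using pos by (simp add: l_def)
      then have "apply_cadlag (y u) (l * s) = x (t * s) / lil_scale \<gamma> u"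
        using ls by (simp only: y scaleR_cadlag.rep_eq apply_rescaled_path[OF x \<open>u > 0\<close>]) simp
      then have yt: "apply_cadlag (y t) s = R * apply_cadlag (y u) (l * s)"
        using s ls pos
        by (simp add: y[THEN fun_cong, of t] R_def scaleR_cadlag.rep_eq
            apply_rescaled_path[OF x \<open>t > 0\<close>])
      have "\<bar>apply_cadlag (y u) (l * s) - apply_cadlag g (l * s)\<bar> \<le> e / 8"
        using abs_apply_cadlag_le_norm[OF ls, of "y u - g"] yg by (simp add: minus_cadlag.rep_eq)
      then have "R * \<bar>apply_cadlag (y u) (l * s) - apply_cadlag g (l * s)\<bar> \<le> 2 * (e / 8)"
        using \<open>R < q\<close> q(2) \<open>R \<ge> 1\<close> by (intro mult_mono) auto
      then have 1: "\<bar>R * apply_cadlag (y u) (l * s) - R * apply_cadlag g (l * s)\<bar> \<le> e / 4"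
        using \<open>R \<ge> 1\<close> by (simp add: abs_mult flip: right_diff_distrib)
      have "(R - 1) * \<bar>apply_cadlag g (l * s)\<bar> \<le> (q - 1) * B"
        using \<open>R < q\<close> \<open>R \<ge> 1\<close> q abs_apply_cadlag_le_norm[OF ls, of g] B(1)[OF g]
        by (intro mult_mono) auto
      then have 2: "\<bar>R * apply_cadlag g (l * s) - apply_cadlag g (l * s)\<bar> \<le> e / 8"
        using \<open>R \<ge> 1\<close> q(3) abs_mult[of "R - 1" "apply_cadlag g (l * s)"] by (simp add: algebra_simps)
      have "\<bar>l * s - s\<bar> = (1 - l) * s" using mult_right_mono[of l 1 s] s l by (simp add: algebra_simps)
      also have "\<dots> \<le> 1 - l" using s l by (intro mult_left_le) auto
      also have "\<dots> < d" by fact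
      finally have 3: "\<bar>apply_cadlag g (l * s) - apply_cadlag g s\<bar> < e / 8"
        using equi g ls s by blast
      \<comment> \<open>The errors are e/4 from \<open>y u\<close> against \<open>g\<close>, e/8
        from the factor \<open>R\<close>, and e/8 from the time change.\<close>
      show "\<bar>apply_cadlag (y t - g) s\<bar> \<le> e / 2"
        using 1 2 3 unfolding minus_cadlag.rep_eq yt by linarith
    qed
    then show ?thesis
      using infdist_le[OF g, of "y t"] e by (simp add: dist_norm)
  qed
  then show "eventually (\<lambda>t. dist (infdist (y t) K) 0 < e) at_top"
    unfolding eventually_at_top_linorder by (auto simp: dist_real_def infdist_nonneg)
qed

section \<open>Exponential probability bounds from a large deviation principle\<close>

text \<open>Otherwise \<open>F\<close> contains a sequence whose rates are below r + 1/(k+1). It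
  lies in a compact sublevel set, so a subsequence converges; the limit is in \<open>F\<close> and
  in every closed sublevel set above \<open>r\<close>, hence has rate at most
  \<open>r\<close>.\<close>

lemma good_rate_function_gap:
  assumes good: "good_rate_function I" and "closed F" and "r \<ge> 0"
    and disj: "\<And>f. f \<in> F \<Longrightarrow> \<not> I f \<le> ennreal r"
  shows "\<exists>b>r. \<forall>f\<in>F. ennreal b \<le> I f"
proof (rule ccontr)
  assume "\<not> ?thesis"
  then have "\<exists>f\<in>F. I f < ennreal (r + 1 / real (Suc k))" for k
    by (auto simp: not_le dest!: spec[of _ "r + 1 / real (Suc k)"])
  then obtain f where f: "\<And>k. f k \<in> F" "\<And>k. I (f k) < ennreal (r + 1 / real (Suc k))" by metis
  have cpt: "compact {f. I f \<le> ennreal (r + 1 / real (Suc k))}" for k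
    using \<open>r \<ge> 0\<close> by (intro good[unfolded good_rate_function_def, rule_format]) simp
  have le: "I (f k) \<le> ennreal (r + 1 / real (Suc m))" if "m \<le> k" for k m
  proof -
    have "1 / real (Suc k) \<le> 1 / real (Suc m)" using that by (simp add: frac_le)
    then have "ennreal (r + 1 / real (Suc k)) \<le> ennreal (r + 1 / real (Suc m))"
      by (intro ennreal_leI) simp
    with f(2)[of k] show ?thesis by simp
  qed
  have "\<forall>k. f k \<in> {f. I f \<le> ennreal (r + 1 / real (Suc 0))}" using le[of 0] by simp
  then obtain g \<phi> where g: "strict_mono \<phi>" "(f \<circ> \<phi>) \<longlonglongrightarrow> g"
    by (rule seq_compactE[OF compact_imp_seq_compact[OF cpt[of 0]]])
  have "g \<in> F"
    using \<open>closed F\<close> f(1) g(2) unfolding closed_sequential_limits by (metis comp_apply)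
  moreover have "I g \<le> ennreal (r + 1 / real (Suc m))" for m
  proof -
    have "eventually (\<lambda>k. (f \<circ> \<phi>) k \<in> {f. I f \<le> ennreal (r + 1 / real (Suc m))}) sequentially"
      using eventually_ge_at_top[of m] 
    proof eventually_elim
      case (elim k)
      then have "m \<le> \<phi> k" using seq_suble[OF g(1), of k] by linarith
      from le[OF this] show ?case by simp
    qed
    from Lim_in_closed_set[OF compact_imp_closed[OF cpt] this _ g(2)] show ?thesis by simp
  qed
  moreover have "(\<lambda>m. ennreal (r + 1 / real (Suc m))) \<longlonglongrightarrow> ennreal r"
    by (intro tendsto_ennrealI) real_asymp
  ultimately have "I g \<le> ennreal r"
    by (intro LIMSEQ_le_const) auto
  with disj \<open>g \<in> F\<close> show False by blast
qed

context prob_space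
begin

text \<open>The gap between \<open>c\<close> and \<open>b\<close> absorbs the error in the limes
  superior and turns it into an explicit bound for all large times.\<close>

lemma ldp_closed_bound:
  assumes ldp: "large_deviation_principle Y I a" and "closed F"
    and "b > c" "b \<ge> 0" and b: "\<And>f. f \<in> F \<Longrightarrow> ennreal b \<le> I f"
  shows "\<forall>\<^sub>F t in at_top. prob {\<omega>\<in>space M. Y t \<omega> \<in> F} \<le> exp (- c * a t)"
proof -
  have "ennreal b \<le> (INF f\<in>F. I f)" using b by (rule INF_greatest)
  then have "ereal b \<le> enn2ereal (INF f\<in>F. I f)"
    using \<open>b \<ge> 0\<close> by (metis enn2ereal_ennreal less_eq_ennreal.rep_eq)
  moreover have "ereal c < ereal b" using \<open>b > c\<close> by simp
  ultimately have "ereal c < enn2ereal (INF f\<in>F. I f)" by (rule less_le_trans[rotated])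
  then have "- enn2ereal (INF f\<in>F. I f) < ereal (- c)"
    by (metis ereal_minus_less_minus uminus_ereal.simps(1))
  moreover have "Limsup at_top (\<lambda>t. ereal (1 / a t) * ereal_ln (prob {\<omega>\<in>space M. Y t \<omega> \<in> F}))
        \<le> - enn2ereal (INF f\<in>F. I f)"
    using ldp \<open>closed F\<close> by (auto simp: large_deviation_principle_def)
  ultimately have "Limsup at_top (\<lambda>t. ereal (1 / a t) * ereal_ln (prob {\<omega>\<in>space M. Y t \<omega> \<in> F})) < ereal (- c)"
    by (rule order_le_less_trans[rotated])
  from Limsup_lessD[OF this] eventually_gt_at_top[of 0] show ?thesis
  proof eventually_elim
    case (elim t)
    have a: "a t > 0" using ldp elim by (auto simp: large_deviation_principle_def)
    define p where "p = prob {\<omega>\<in>space M. Y t \<omega> \<in> F}"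
    show ?case
    proof (cases "p \<le> 0")
      case True
      then show ?thesis using order_trans[OF True exp_ge_zero] by (simp only: p_def)
    next
      case False
      then have "ln p / a t < - c" using elim by (simp add: ereal_ln_def p_def)
      then have "ln p < - c * a t" using a by (simp add: pos_divide_less_eq)
      then have "p \<le> exp (- c * a t)"
        using False ln_le_cancel_iff[of p "exp (- c * a t)"] by simp
      then show ?thesis by (simp add: p_def)
    qed
  qed
qed

lemma ldp_open_bound:
  assumes ldp: "large_deviation_principle Y I a" and "open U" "f \<in> U" and f: "I f < ennreal c"
  shows "\<forall>\<^sub>F t in at_top. exp (- c * a t) \<le> prob {\<omega>\<in>space M. Y t \<omega> \<in> U}"
proof -
  have "c > 0" using f by (metis ennreal_eq_0_iff linorder_not_le not_less_zero)
  have "(INF f\<in>U. I f) < ennreal c" using INF_lower[OF \<open>f \<in> U\<close>, of I] f by simp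
  then have "enn2ereal (INF f\<in>U. I f) < ereal c"
    using \<open>c > 0\<close> by (metis enn2ereal_ennreal less_ennreal.rep_eq less_imp_le)
  then have "ereal (- c) < - enn2ereal (INF f\<in>U. I f)"
    by (metis ereal_minus_less_minus uminus_ereal.simps(1))
  moreover have "- enn2ereal (INF f\<in>U. I f)
      \<le> Liminf at_top (\<lambda>t. ereal (1 / a t) * ereal_ln (prob {\<omega>\<in>space M. Y t \<omega> \<in> U}))"
    using ldp \<open>open U\<close> by (auto simp: large_deviation_principle_def)
  ultimately have "ereal (- c) < Liminf at_top (\<lambda>t. ereal (1 / a t) * ereal_ln (prob {\<omega>\<in>space M. Y t \<omega> \<in> U}))"
    by (rule order_less_le_trans)
  from less_LiminfD[OF this] eventually_gt_at_top[of 0] show ?thesis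
  proof eventually_elim
    case (elim t)
    have a: "a t > 0" using ldp elim by (auto simp: large_deviation_principle_def)
    define p where "p = prob {\<omega>\<in>space M. Y t \<omega> \<in> U}"
    \<comment> \<open>For \<open>p = 0\<close> the scaled \<open>ereal_ln\<close> would be
      -\<infinity>, below the lower bound.\<close>
    have "p > 0" using elim a by (auto simp: ereal_ln_def p_def split: if_splits)
    then have "- c < ln p / a t" using elim by (simp add: ereal_ln_def p_def)
    then have "- c * a t < ln p" using a by (simp add: pos_less_divide_eq)
    then have "exp (- c * a t) \<le> p"
      using \<open>p > 0\<close> ln_le_cancel_iff[of "exp (- c * a t)" p] by simp
    then show ?case by (simp add: p_def)
  qed
qed

section \<open>Independence of increments in different geometric blocks\<close>

text \<open>Independence is a condition on finite subfamilies, and each of these lies in an initial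
  segment. It is needed because \<open>independent_increments\<close> speaks of finitely many times
  only.\<close>

lemma indep_vars_UNIV_nat:
  fixes Z :: "nat \<Rightarrow> 'a \<Rightarrow> 'b"
  assumes "\<And>n. indep_vars N Z {..<n}"
  shows "indep_vars N Z UNIV"
  unfolding indep_vars_def2
proof (intro conjI ballI)
  show "random_variable (N i) (Z i)" for i
    using assms[of "Suc i"] by (auto simp: indep_vars_def2)
  show "indep_sets (\<lambda>i. {Z i -` A \<inter> space M |A. A \<in> sets (N i)}) UNIV"
  proof (subst indep_sets_finite_index_sets, intro allI impI)
    fix J :: "nat set" assume "finite J"
    then obtain n where "J \<subseteq> {..<n}"
      by (metis finite_nat_iff_bounded)
    then show "indep_sets (\<lambda>i. {Z i -` A \<inter> space M |A. A \<in> sets (N i)}) J"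
      using indep_vars_subset[OF assms] by (auto simp: indep_vars_def2)
  qed
qed

text \<open>The n-th event involves \<open>X\<close> only on \<open>[m ^ n, m ^ Suc n]\<close>; the
  cell \<open>j = 0\<close> is left out because it contains all earlier blocks. The increments of
  all blocks are read off a single increasing sequence of times and then grouped.\<close>

lemma indep_events_geometric_grid:
  fixes X :: "real \<Rightarrow> 'a \<Rightarrow> real"
  assumes inc: "independent_increments X" and m: "m \<ge> (2::nat)"
    and [measurable]: "\<And>n j. B n j \<in> sets borel"
  shows "indep_events (\<lambda>n. {\<omega>\<in>space M. \<forall>j\<in>{1..<m}.
    X (real (Suc j * m ^ n)) \<omega> - X (real (j * m ^ n)) \<omega> \<in> B n j}) UNIV"
proof -
  define p where "p = m - 1"
  have p: "p > 0" "m = Suc p" using m by (auto simp: p_def)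
  \<comment> \<open>\<open>\<tau>\<close> enumerates the points \<open>j * m ^ n\<close> with \<open>1 \<le> j < m\<close> in increasing order\<close>
  define \<tau> where "\<tau> i = (1 + i mod p) * m ^ (i div p)" for i
  have \<tau>_Suc: "\<tau> (Suc i) = \<tau> i + m ^ (i div p)" for i
  proof (cases "Suc (i mod p) = p")
    \<comment> \<open>The last point of a block is \<open>p * m ^ n\<close> with
      \<open>n = i div p\<close>; adding \<open>m ^ n\<close> gives \<open>m ^ Suc n\<close>, the
      start of the next block, because \<open>m = Suc p\<close>.\<close>
    case True
    then have "Suc i mod p = 0" "Suc i div p = Suc (i div p)"
      by (simp_all add: mod_Suc div_Suc)
    then show ?thesis
      using True p(2) by (simp add: \<tau>_def)
  next
    case False
    then have "Suc i mod p = Suc (i mod p)" "Suc i div p = i div p"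
      by (simp_all add: mod_Suc div_Suc)
    then show ?thesis by (simp add: \<tau>_def)
  qed
  define Z where "Z i \<omega> = X (real (\<tau> (Suc i))) \<omega> - X (real (\<tau> i)) \<omega>" for i \<omega>
  have "real (\<tau> i) < real (\<tau> (Suc i))" for i
    unfolding \<tau>_Suc using p by simp
  then have "indep_vars (\<lambda>_. borel) Z {..<n}" for n
    using inc[unfolded independent_increments_def, rule_format, of "\<lambda>i. real (\<tau> i)" n]
    by (simp add: Z_def[abs_def])
  then have Z: "indep_vars (\<lambda>_. borel) Z UNIV"
    by (rule indep_vars_UNIV_nat)
  \<comment> \<open>The indices of block \<open>n\<close>. Restrictions of independent variables to
    disjoint index sets are independent vectors.\<close>
  define D where "D n = {n * p..<n * p + p}" for n
  have "disjoint_family D"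
  proof -
    have "i div p = n" if "i \<in> D n" for i n
      using that by (intro div_nat_eqI) (simp_all add: D_def mult.commute)
    then show ?thesis unfolding disjoint_family_on_def by blast
  qed
  then have W: "indep_vars (\<lambda>n. PiM (D n) (\<lambda>_. borel)) (\<lambda>n \<omega>. restrict (\<lambda>i. Z i \<omega>) (D n)) UNIV"
    using indep_vars_restrict[OF Z, of UNIV D] by simp
  \<comment> \<open>\<open>Suc (i - n * p)\<close> turns the offset within the block, counted from
    0, into the cell number \<open>j\<close>, counted from 1.\<close>
  have "indep_events (\<lambda>n. {\<omega>\<in>space M. \<forall>i\<in>D n. restrict (\<lambda>i. Z i \<omega>) (D n) i \<in> B n (Suc (i - n * p))}) UNIV"
  proof (rule indep_eventsI_indep_vars[OF W])
    fix n :: nat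
    have "finite (D n)" by (simp add: D_def)
    then show "{x \<in> space (Pi\<^sub>M (D n) (\<lambda>_. borel)). \<forall>i\<in>D n. x i \<in> B n (Suc (i - n * p))}
        \<in> sets (Pi\<^sub>M (D n) (\<lambda>_. borel))"
      by measurable
  qed
  moreover have "(\<forall>i\<in>D n. restrict (\<lambda>i. Z i \<omega>) (D n) i \<in> B n (Suc (i - n * p))) \<longleftrightarrow>
      (\<forall>j\<in>{1..<m}. X (real (Suc j * m ^ n)) \<omega> - X (real (j * m ^ n)) \<omega> \<in> B n j)" for n \<omega>
  proof -
    have *: "Z (n * p + j) \<omega> = X (real (Suc (Suc j) * m ^ n)) \<omega> - X (real (Suc j * m ^ n)) \<omega>"
      if "j < p" for j
    proof -
      have "(n * p + j) div p = n" "(n * p + j) mod p = j"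
        using that by auto
      then show ?thesis
        unfolding Z_def \<tau>_Suc by (simp add: \<tau>_def algebra_simps)
    qed
    have D: "D n = (\<lambda>j. n * p + j) ` {..<p}"
      unfolding D_def lessThan_atLeast0 image_add_atLeastLessThan by (simp add: add.commute)
    have m': "{1..<m} = Suc ` {..<p}"
      unfolding p(2) lessThan_atLeast0 image_Suc_atLeastLessThan by simp
    then show ?thesis
      unfolding m' D Set.ball_simps using * by (intro ball_cong refl) (simp only: lessThan_iff
        restrict_apply' imageI add_diff_cancel_left')
  qed
  ultimately show ?thesis by simp
qed

end

section \<open>Limit points of a family that approaches a compact set\<close>

lemma filterlim_power_Suc_at_top:
  fixes c :: real
  assumes "c > 1"
  shows "filterlim (\<lambda>n. c ^ Suc n) at_top sequentially"
  using assms by real_asymp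

lemma infdist_tendsto_0_attaining:
  assumes "K \<noteq> {}" and "(\<lambda>n. infdist (z n) K) \<longlonglongrightarrow> 0"
  shows "\<exists>g. (\<forall>n. g n \<in> K) \<and> (\<lambda>n. dist (z n) (g n)) \<longlonglongrightarrow> 0"
proof -
  have "\<exists>g\<in>K. dist (z n) g < infdist (z n) K + inverse (real (Suc n))" for n
    using cInf_lessD[of "dist (z n) ` K" "infdist (z n) K + inverse (real (Suc n))"] assms(1)
    by (auto simp: infdist_notempty)
  then obtain g where g: "\<And>n. g n \<in> K" "\<And>n. dist (z n) (g n) < infdist (z n) K + inverse (real (Suc n))"
    by metis
  have "(\<lambda>n. infdist (z n) K + inverse (real (Suc n))) \<longlonglongrightarrow> 0 + 0"
    by (intro tendsto_add assms(2) LIMSEQ_inverse_real_of_nat)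
  then have lim: "(\<lambda>n. infdist (z n) K + inverse (real (Suc n))) \<longlonglongrightarrow> 0" by simp
  have "(\<lambda>n. dist (z n) (g n)) \<longlonglongrightarrow> 0"
    by (rule tendsto_sandwich[OF _ _ tendsto_const lim])
      (intro always_eventually allI zero_le_dist less_imp_le[OF g(2)])+
  with g(1) show ?thesis by blast
qed

text \<open>Points of \<open>K\<close> whose distance to the family tends to 0 have a convergent
  subsequence, and the family follows it to the same limit.\<close>

lemma relatively_compact_at_topI:
  assumes K: "compact K" "K \<noteq> {}" and lim: "((\<lambda>t. infdist (y t) K) \<longlongrightarrow> 0) at_top"
  shows "relatively_compact_at_top y"
  unfolding relatively_compact_at_top_def
proof (intro allI impI)
  fix t :: "nat \<Rightarrow> real" assume "(\<forall>n. t n > 0) \<and> filterlim t at_top sequentially"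
  then have "(\<lambda>n. infdist (y (t n)) K) \<longlonglongrightarrow> 0"
    by (intro filterlim_compose[OF lim]) auto
  from infdist_tendsto_0_attaining[OF K(2) this]
  obtain g where g: "\<forall>n. g n \<in> K" "(\<lambda>n. dist (y (t n)) (g n)) \<longlonglongrightarrow> 0" by blast
  obtain f r where r: "strict_mono r" "(g \<circ> r) \<longlonglongrightarrow> f"
    using seq_compactE[OF compact_imp_seq_compact[OF K(1)] g(1)] by metis
  have "(\<lambda>n. dist (y (t (r n))) f) \<longlonglongrightarrow> 0"
  proof (rule tendsto_sandwich[OF _ _ tendsto_const])
    have "(\<lambda>n. dist (y (t (r n))) (g (r n))) \<longlonglongrightarrow> 0"
      using LIMSEQ_subseq_LIMSEQ[OF g(2) r(1)] by (simp add: comp_def)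
    moreover have "(\<lambda>n. dist (g (r n)) f) \<longlonglongrightarrow> 0"
      using r(2) tendsto_dist_iff[of "g \<circ> r"] by (simp add: comp_def)
    ultimately have "(\<lambda>n. dist (y (t (r n))) (g (r n)) + dist (g (r n)) f) \<longlonglongrightarrow> 0 + 0"
      by (rule tendsto_add)
    then show "(\<lambda>n. dist (y (t (r n))) (g (r n)) + dist (g (r n)) f) \<longlonglongrightarrow> 0" by simp
  qed (auto intro!: always_eventually dist_triangle)
  then have "(\<lambda>n. y (t (r n))) \<longlonglongrightarrow> f"
    using tendsto_dist_iff by blast
  with r(1) show "\<exists>r f. strict_mono r \<and> (\<lambda>n. y (t (r n))) \<longlonglongrightarrow> f" by blast
qed

lemma limit_points_at_top_subset:
  assumes "closed K" "K \<noteq> {}" and lim: "((\<lambda>t. infdist (y t) K) \<longlongrightarrow> 0) at_top"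
  shows "limit_points_at_top y \<subseteq> K"
proof
  fix f assume "f \<in> limit_points_at_top y"
  then obtain t :: "nat \<Rightarrow> real" where t: "filterlim t at_top sequentially" "(\<lambda>n. y (t n)) \<longlonglongrightarrow> f"
    by (auto simp: limit_points_at_top_def)
  have "(\<lambda>n. infdist (y (t n)) K) \<longlonglongrightarrow> infdist f K"
    by (rule tendsto_infdist[OF t(2)])
  moreover have "(\<lambda>n. infdist (y (t n)) K) \<longlonglongrightarrow> 0"
    by (rule filterlim_compose[OF lim t(1)])
  ultimately have "infdist f K = 0" by (rule LIMSEQ_unique)
  then show "f \<in> K" using in_closed_iff_infdist_zero[OF assms(1,2)] by blast
qed

lemma limit_points_at_topI:
  fixes y :: "real \<Rightarrow> 'b::metric_space"
  assumes "\<And>e T. e > 0 \<Longrightarrow> \<exists>t\<ge>T. dist (y t) f < e"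
  shows "f \<in> limit_points_at_top y"
proof -
  have "\<exists>t\<ge>real (Suc n). dist (y t) f < inverse (real (Suc n))" for n
    using assms[of "inverse (real (Suc n))" "real (Suc n)"] by simp
  then obtain t where t: "\<And>n. t n \<ge> real (Suc n)" "\<And>n. dist (y (t n)) f < inverse (real (Suc n))"
    by metis
  have "t n > 0" "real n \<le> t n" for n using t(1)[of n] by simp_all
  moreover have "filterlim t at_top sequentially"
    by (rule filterlim_at_top_mono[OF filterlim_real_sequentially])
      (simp add: \<open>\<And>n. real n \<le> t n\<close>)
  moreover have "(\<lambda>n. dist (y (t n)) f) \<longlonglongrightarrow> 0"
    by (rule tendsto_sandwich[OF _ _ tendsto_const LIMSEQ_inverse_real_of_nat])
      (intro always_eventually allI zero_le_dist less_imp_le[OF t(2)])+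
  then have "(\<lambda>n. y (t n)) \<longlonglongrightarrow> f"
    using tendsto_dist_iff by blast
  ultimately show ?thesis by (auto simp: limit_points_at_top_def)
qed

section \<open>From grid increments to uniform closeness\<close>

text \<open>Nothing is assumed about the increment of \<open>y\<close> over the first cell: there
  \<open>g\<close> and \<open>h\<close> start at 0 and move by at most \<open>e\<close>. The other
  cells are summed, with total error at most \<open>real m * b\<close>, and equicontinuity bridges
  the space between grid points. Here \<open>g\<close> is an element of the compact set near the
  path \<open>y\<close>.\<close>

lemma norm_cadlag_diff_le_grid:
  assumes m: "m \<ge> (1::nat)" and g0: "apply_cadlag g 0 = 0" and h0: "apply_cadlag h 0 = 0"
    and equi_g: "\<And>u v. u \<in> {0..1} \<Longrightarrow> v \<in> {0..1} \<Longrightarrow> \<bar>u - v\<bar> \<le> 1 / real m \<Longrightarrow>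
        \<bar>apply_cadlag g u - apply_cadlag g v\<bar> \<le> e"
    and equi_h: "\<And>u v. u \<in> {0..1} \<Longrightarrow> v \<in> {0..1} \<Longrightarrow> \<bar>u - v\<bar> \<le> 1 / real m \<Longrightarrow>
        \<bar>apply_cadlag h u - apply_cadlag h v\<bar> \<le> e"
    and y: "norm (y - g) \<le> e" and me: "real m * b \<le> e"
    and grid: "\<And>j. j \<in> {1..<m} \<Longrightarrow>
       \<bar>(apply_cadlag y (real (Suc j) / real m) - apply_cadlag y (real j / real m)) -
        (apply_cadlag h (real (Suc j) / real m) - apply_cadlag h (real j / real m))\<bar> \<le> b"
  shows "norm (g - h) \<le> 7 * e"
proof (rule norm_cadlag_le)
  fix s :: real assume s: "s \<in> {0..1}"
  define w where "w j = apply_cadlag y (real j / real m) - apply_cadlag h (real j / real m)" for j :: nat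
  have in01: "real j / real m \<in> {0..1}" if "j \<le> m" for j using that m by simp
  have yg: "\<bar>apply_cadlag y u - apply_cadlag g u\<bar> \<le> e" if "u \<in> {0..1}" for u
    using abs_apply_cadlag_le_norm[OF that, of "y - g"] y by (simp add: minus_cadlag.rep_eq)
  have "e \<ge> 0" using y norm_ge_zero order_trans by blast
  \<comment> \<open>One \<open>e\<close> each for \<open>g\<close> and \<open>h\<close> over the
    first cell and one for \<open>y\<close> against \<open>g\<close>.\<close>
  have w1: "\<bar>w 1\<bar> \<le> 3 * e"
    using equi_g[of "1 / real m" 0] equi_h[of "1 / real m" 0] yg[OF in01[of 1]] m g0 h0
    by (simp add: w_def)
  have w: "\<bar>w j - w 1\<bar> \<le> real (j - 1) * b" if "1 \<le> j" "j \<le> m" for j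
    using that
  proof (induction j rule: dec_induct)
    case (step j)
    then have "\<bar>w (Suc j) - w j\<bar> \<le> b"
      using grid[of j] by (simp add: w_def)
    then have "\<bar>w (Suc j) - w 1\<bar> \<le> real (j - 1) * b + b" using step by linarith
    also have "\<dots> = real (Suc j - 1) * b" using step by (simp add: of_nat_diff algebra_simps)
    finally show ?case .
  qed simp
  have b: "real (j - 1) * b \<le> e" if "j \<le> m" for j
  proof (cases "b \<ge> 0")
    case True
    then have "real (j - 1) * b \<le> real m * b" using that by (intro mult_right_mono) auto
    with me show ?thesis by linarith
  next
    case False
    then have "real (j - 1) * b \<le> 0" by (intro mult_nonneg_nonpos) auto
    with \<open>e \<ge> 0\<close> show ?thesis by linarith
  qed
  \<comment> \<open>The index of the last grid point not beyond \<open>s\<close>.\<close>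
  define j where "j = nat \<lfloor>real m * s\<rfloor>"
  have js: "real j \<le> real m * s" "real m * s < real j + 1"
    using s by (auto simp: j_def)
  have "real m * s \<le> real m * 1" using s by (intro mult_left_mono) auto
  with js have "j \<le> m" by linarith
  have "s - real j / real m = (real m * s - real j) / real m"
    using m by (simp add: field_simps)
  then have "\<bar>s - real j / real m\<bar> \<le> 1 / real m"
    using js by (simp add: divide_right_mono)
  note close = equi_g[OF s in01[OF \<open>j \<le> m\<close>] this] equi_h[OF s in01[OF \<open>j \<le> m\<close>] this]
  \<comment> \<open>For \<open>j > 0\<close>, \<open>y\<close> and \<open>h\<close> differ by at
    most 3e + e there, and passing from \<open>y\<close> to \<open>g\<close> costs another
    \<open>e\<close>. Moving from \<open>s\<close> to the grid point in both \<open>g\<close> and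
    \<open>h\<close> will give the remaining 2e.\<close>
  have "\<bar>apply_cadlag g (real j / real m) - apply_cadlag h (real j / real m)\<bar> \<le> 5 * e"
  proof (cases "j = 0")
    case False
    then have "\<bar>w j\<bar> \<le> 4 * e"
      using w[of j] b[of j] w1 \<open>j \<le> m\<close> by linarith
    then show ?thesis
      using yg[OF in01[OF \<open>j \<le> m\<close>]] unfolding w_def by linarith
  qed (use g0 h0 \<open>e \<ge> 0\<close> in simp)
  with close show "\<bar>apply_cadlag (g - h) s\<bar> \<le> 7 * e"
    unfolding minus_cadlag.rep_eq by linarith
qed

text \<open>Again a statement about a single path. At arbitrarily late times the path is both near
  \<open>K\<close> and, on a fine grid, near a given \<open>h\<close> in its increments, so it is
  uniformly near \<open>h\<close>, which in turn is near \<open>f\<close>.\<close>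

lemma limit_points_at_top_supset:
  fixes y :: "real \<Rightarrow> cadlag"
  assumes K: "compact K" "K \<noteq> {}" and lim: "((\<lambda>t. infdist (y t) K) \<longlongrightarrow> 0) at_top"
    and cont: "\<And>g. g \<in> K \<Longrightarrow> continuous_on {0..1} (apply_cadlag g)"
    and zero: "\<And>g. g \<in> K \<Longrightarrow> apply_cadlag g 0 = 0"
    and D: "D \<subseteq> K" "\<And>f e. f \<in> K \<Longrightarrow> e > 0 \<Longrightarrow> \<exists>h\<in>D. dist h f < e"
    and io: "\<And>h m. h \<in> D \<Longrightarrow> m \<ge> (2::nat) \<Longrightarrow> \<exists>\<^sub>\<infinity>n. \<forall>j\<in>{1..<m}.
       \<bar>(apply_cadlag (y (real m ^ Suc n)) (real (Suc j) / real m) -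
          apply_cadlag (y (real m ^ Suc n)) (real j / real m)) -
        (apply_cadlag h (real (Suc j) / real m) - apply_cadlag h (real j / real m))\<bar> < 1 / (real m)\<^sup>2"
  shows "K \<subseteq> limit_points_at_top y"
proof
  fix f assume f: "f \<in> K"
  show "f \<in> limit_points_at_top y"
  proof (rule limit_points_at_topI)
    fix e0 T :: real assume "e0 > 0"
    \<comment> \<open>The final estimate is e + 7e + e = 9e, below \<open>e0\<close>.\<close>
    define e where "e = e0 / 10"
    have e: "e > 0" using \<open>e0 > 0\<close> by (simp add: e_def)
    obtain d where d: "d > 0" and equi: "\<And>g u v. g \<in> K \<Longrightarrow> u \<in> {0..1} \<Longrightarrow> v \<in> {0..1} \<Longrightarrow>
        \<bar>u - v\<bar> < d \<Longrightarrow> \<bar>apply_cadlag g u - apply_cadlag g v\<bar> < e"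
      using compact_cadlag_equicontinuous[OF K(1) cont e] by blast
    obtain m0 where m0: "inverse (real (Suc m0)) < min d e"
      using reals_Archimedean[of "min d e"] d e by auto
    \<comment> \<open>The mesh \<open>1 / m\<close> is below the modulus \<open>d\<close>, and below
      \<open>e\<close> so that the accumulated grid error m * (1/m^2) is at most
      \<open>e\<close>.\<close>
    define m where "m = m0 + 2"
    have "1 / real m \<le> inverse (real (Suc m0))"
      by (simp add: m_def field_simps)
    with m0 have m: "m \<ge> 2" "1 / real m < d" "1 / real m < e"
      by (auto simp: m_def)
    obtain h where h: "h \<in> D" "dist h f < e" using D(2)[OF f e] by blast
    have "real m > 1" using m by simp
  then have pow: "filterlim (\<lambda>n. real m ^ Suc n) at_top sequentially"
      by (rule filterlim_power_Suc_at_top)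
    have "\<forall>\<^sub>F t in at_top. infdist (y t) K < e \<and> T \<le> t"
      using order_tendstoD(2)[OF lim e] eventually_ge_at_top[of T] by eventually_elim auto
    then have "\<forall>\<^sub>F n in sequentially. infdist (y (real m ^ Suc n)) K < e \<and> T \<le> real m ^ Suc n"
      using pow by (rule eventually_compose_filterlim)
    \<comment> \<open>An event that holds infinitely often meets a condition that holds
      eventually.\<close>
    then have "\<exists>n. infdist (y (real m ^ Suc n)) K < e \<and> T \<le> real m ^ Suc n \<and>
        (\<forall>j\<in>{1..<m}. \<bar>(apply_cadlag (y (real m ^ Suc n)) (real (Suc j) / real m) -
          apply_cadlag (y (real m ^ Suc n)) (real j / real m)) -
        (apply_cadlag h (real (Suc j) / real m) - apply_cadlag h (real j / real m))\<bar> < 1 / (real m)\<^sup>2)"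
      by (rule frequently_ex[OF frequently_rev_mp[OF io[OF h(1) m(1), unfolded cofinite_eq_sequentially]
        eventually_mono]]) blast
    then obtain n where n: "infdist (y (real m ^ Suc n)) K < e" "T \<le> real m ^ Suc n"
      and grid: "\<And>j. j \<in> {1..<m} \<Longrightarrow>
        \<bar>(apply_cadlag (y (real m ^ Suc n)) (real (Suc j) / real m) -
          apply_cadlag (y (real m ^ Suc n)) (real j / real m)) -
        (apply_cadlag h (real (Suc j) / real m) - apply_cadlag h (real j / real m))\<bar> < 1 / (real m)\<^sup>2"
      by blast
    define t where "t = real m ^ Suc n"
    have "(INF g\<in>K. dist (y t) g) < e"
      using n(1) K(2) by (simp add: t_def infdist_def)
    then obtain g where g: "g \<in> K" "norm (y t - g) < e"
      using cInf_lessD[of "dist (y t) ` K" e] K(2) by (auto simp: dist_norm)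
    have "norm (g - h) \<le> 7 * e"
    proof (rule norm_cadlag_diff_le_grid)
      show "real m * (1 / (real m)\<^sup>2) \<le> e"
        using m by (simp add: power2_eq_square)
      show "norm (y t - g) \<le> e" using g by simp
      show "\<bar>apply_cadlag g u - apply_cadlag g v\<bar> \<le> e" "\<bar>apply_cadlag h u - apply_cadlag h v\<bar> \<le> e"
        if "u \<in> {0..1}" "v \<in> {0..1}" "\<bar>u - v\<bar> \<le> 1 / real m" for u v
        using equi[OF g(1) that(1,2)] equi[of h u v] that m(2) h(1) D(1) by auto
    qed (use m zero g(1) h(1) D(1) grid in \<open>auto simp: t_def less_imp_le\<close>)
    moreover have "y t - f = (y t - g) + (g - h) + (h - f)" by simp
    then have "norm (y t - f) \<le> norm (y t - g) + norm (g - h) + norm (h - f)"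
      using norm_triangle_ineq[of "y t - g" "g - h"] norm_triangle_ineq[of "(y t - g) + (g - h)" "h - f"]
      by simp
    ultimately have "norm (y t - f) < e0"
      using g(2) h(2) e unfolding dist_norm e_def by linarith
    then show "\<exists>t\<ge>T. dist (y t) f < e0"
      using n(2) by (auto simp: t_def dist_norm)
  qed
qed

section \<open>Almost sure behaviour along geometric sequences\<close>

context prob_space
begin

lemma large_deviation_principle_cong:
  assumes ldp: "large_deviation_principle Y I a" and eq: "\<And>t. t > 0 \<Longrightarrow> a t = b t"
  shows "large_deviation_principle Y I b"
proof -
  have ev: "\<forall>\<^sub>F t in at_top. a t = b t"
    using eventually_gt_at_top[of 0] by eventually_elim (rule eq)
  then have "\<forall>\<^sub>F t in at_top. ereal (1 / a t) * p t = ereal (1 / b t) * p t" for p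
    by eventually_elim simp
  note Liminf_eq[OF this] Limsup_eq[OF this]
  moreover have "filterlim a at_top at_top \<longleftrightarrow> filterlim b at_top at_top"
    using ev by (rule filterlim_cong[OF refl refl])
  ultimately show ?thesis
    using ldp eq by (simp add: large_deviation_principle_def)
qed

text \<open>On the closed set of points at distance at least \<open>e\<close> from the sublevel set
  the rate is at least some \<open>b > 1 / 2\<close>. With the speed 2 log log t, the probabilities
  at \<open>c ^ n\<close> are then of order n^(-2r) with 2r > 1, and the first Borel-Cantelli lemma
  applies.\<close>

lemma AE_infdist_sublevel_tendsto_0:
  fixes Y :: "real \<Rightarrow> 'a \<Rightarrow> 'b::metric_space"
  assumes ldp: "large_deviation_principle Y I (\<lambda>t. 2 * ln (ln (max t (exp (exp 1)))))"
    and c: "c > 1"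
  shows "AE \<omega> in M. (\<lambda>n. infdist (Y (c ^ n) \<omega>) {f. I f \<le> ennreal (1 / 2)}) \<longlonglongrightarrow> 0"
proof -
  define K where "K = {f. I f \<le> ennreal (1 / 2)}"
  have pow: "filterlim (\<lambda>n. c ^ n) at_top sequentially"
    using c by real_asymp
  have "AE \<omega> in M. \<forall>\<^sub>F n in sequentially. infdist (Y (c ^ n) \<omega>) K < e" if "e > 0" for e :: real
  proof -
    define F where "F = {f. e \<le> infdist f K}"
    have F: "closed F"
      unfolding F_def by (intro closed_Collect_le continuous_intros)
    have "\<not> I f \<le> ennreal (1 / 2)" if "f \<in> F" for f
      using that \<open>e > 0\<close> infdist_zero[of f K] by (auto simp: F_def K_def)
    then obtain b where b: "b > 1 / 2" "\<And>f. f \<in> F \<Longrightarrow> ennreal b \<le> I f"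
      using good_rate_function_gap[of I F "1 / 2"] ldp F by (auto simp: large_deviation_principle_def)
    \<comment> \<open>The midpoint leaves room both for the bound below \<open>b\<close> and for
      summability.\<close>
    define r where "r = (1 / 2 + b) / 2"
    have r: "1 / 2 < r" "r < b" using b by (auto simp: r_def)
    have "\<forall>\<^sub>F t in at_top. prob {\<omega>\<in>space M. Y t \<omega> \<in> F} \<le> exp (- r * (2 * ln (ln (max t (exp (exp 1))))))"
      using b r by (intro ldp_closed_bound[OF ldp F]) auto
    then have "\<forall>\<^sub>F n in sequentially. prob {\<omega>\<in>space M. Y (c ^ n) \<omega> \<in> F} \<le>
        exp (- r * (2 * ln (ln (max (c ^ n) (exp (exp 1))))))"
      using pow by (rule eventually_compose_filterlim)
    moreover have "\<forall>\<^sub>F n in sequentially. c ^ n > exp (exp 1)"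
      using pow by (simp add: filterlim_at_top_dense)
    ultimately have "\<forall>\<^sub>F n in sequentially. norm (prob {\<omega>\<in>space M. Y (c ^ n) \<omega> \<in> F}) \<le>
        ln c powr (- (2 * r)) * real n powr (- (2 * r))"
      using eventually_gt_at_top[of 0]
    proof eventually_elim
      case (elim n)
      have "exp (- r * (2 * ln (ln (max (c ^ n) (exp (exp 1)))))) = (real n * ln c) powr (- (2 * r))"
        using elim c by (simp add: max_absorb1 ln_realpow powr_def mult_ac)
      also have "\<dots> = ln c powr (- (2 * r)) * real n powr (- (2 * r))"
        using c by (simp add: powr_mult)
      finally show ?case using elim by simp
    qed
    moreover have "summable (\<lambda>n. ln c powr (- (2 * r)) * real n powr (- (2 * r)))"
      using r by (intro summable_mult) (simp add: summable_real_powr_iff)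
    ultimately have sum: "summable (\<lambda>n. prob {\<omega>\<in>space M. Y (c ^ n) \<omega> \<in> F})"
      by (rule summable_comparison_test_ev)
    have "{\<omega>\<in>space M. Y (c ^ n) \<omega> \<in> F} \<in> events" for n
    proof -
      have "random_variable borel (Y (c ^ n))"
        using ldp c by (simp add: large_deviation_principle_def)
      then have "Y (c ^ n) -` F \<inter> space M \<in> events"
        using F by (intro measurable_sets) auto
      then show ?thesis by (simp add: vimage_def Int_def conj_commute)
    qed
    from borel_cantelli_AE1[OF this _ sum] AE_space show ?thesis
      by (auto simp: F_def less_top[symmetric] not_le elim!: eventually_mono)
  qed
  \<comment> \<open>Radii 1/(k+1) are enough, which leaves countably many null sets.\<close>
  then have "AE \<omega> in M. \<forall>k. \<forall>\<^sub>F n in sequentially. infdist (Y (c ^ n) \<omega>) K < inverse (real (Suc k))"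
    by (simp add: AE_all_countable)
  then show ?thesis
    unfolding K_def[symmetric]
  proof eventually_elim
    case (elim \<omega>)
    show ?case
    proof (rule tendstoI)
      fix e :: real assume "e > 0"
      then obtain k where k: "inverse (real (Suc k)) < e" using reals_Archimedean by blast
      from elim[rule_format, of k]
      show "\<forall>\<^sub>F n in sequentially. dist (infdist (Y (c ^ n) \<omega>) K) 0 < e"
        by eventually_elim (use k in \<open>auto simp: dist_real_def infdist_nonneg\<close>)
    qed
  qed
qed

text \<open>A rate below 1/2 makes the probability of being near \<open>h\<close> at time
  \<open>m ^ Suc n\<close> at least 1/((n+1) ln m), a divergent harmonic series. Being near
  \<open>h\<close> implies the event on the increments, and these events are independent, so the
  second Borel-Cantelli lemma applies.\<close>

lemma AE_grid_increments_infinitely_often: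
  fixes X :: "real \<Rightarrow> 'a \<Rightarrow> real"
  assumes X: "cadlag_process X" "independent_increments X" and S: "\<And>t. t > 0 \<Longrightarrow> S t > 0"
    and Y: "Y = (\<lambda>t \<omega>. (1 / S t) *\<^sub>R rescaled_path (\<lambda>u. X u \<omega>) t)"
    and ldp: "large_deviation_principle Y I (\<lambda>t. 2 * ln (ln (max t (exp (exp 1)))))"
    and h: "I h < ennreal (1 / 2)" and m: "m \<ge> (2::nat)" and "e > 0"
  shows "AE \<omega> in M. \<exists>\<^sub>\<infinity>n. \<forall>j\<in>{1..<m}.
       \<bar>(apply_cadlag (Y (real m ^ Suc n) \<omega>) (real (Suc j) / real m) -
          apply_cadlag (Y (real m ^ Suc n) \<omega>) (real j / real m)) -
        (apply_cadlag h (real (Suc j) / real m) - apply_cadlag h (real j / real m))\<bar> < e"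
proof -
  define dh where "dh j = apply_cadlag h (real (Suc j) / real m) - apply_cadlag h (real j / real m)" for j :: nat
  \<comment> \<open>The normalisation is moved into the Borel set, so that \<open>A n\<close> below
    concerns increments of \<open>X\<close> itself.\<close>
  define B where "B n j = {x. \<bar>x / S (real m ^ Suc n) - dh j\<bar> < e}" for n j
  have B[measurable]: "B n j \<in> sets borel" for n j
    unfolding B_def by measurable
  define A where "A n = {\<omega>\<in>space M. \<forall>j\<in>{1..<m}.
    X (real (Suc j * m ^ n)) \<omega> - X (real (j * m ^ n)) \<omega> \<in> B n j}" for n
  have A: "indep_events A UNIV"
    unfolding A_def by (rule indep_events_geometric_grid[OF X(2) m B])
  have Yeq: "apply_cadlag (Y (real m ^ Suc n) \<omega>) (real j / real m) =
      X (real (j * m ^ n)) \<omega> / S (real m ^ Suc n)"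
    if "\<omega> \<in> space M" "j \<le> m" for n j \<omega>
  proof -
    have "cadlag_on {0..} (\<lambda>t. X t \<omega>)" using X(1) that by (simp add: cadlag_process_def)
    \<comment> \<open>At time \<open>m ^ Suc n\<close> the grid point \<open>j / m\<close>
      corresponds to the time \<open>j * m ^ n\<close>.\<close>
    moreover have "real m ^ Suc n * (real j / real m) = real (j * m ^ n)" using m by simp
    moreover have "real j / real m \<in> {0..1}" using that m by simp
    moreover have "real m ^ Suc n > 0" using m by simp
    ultimately show ?thesis
      by (simp only: Y scaleR_cadlag.rep_eq apply_rescaled_path) simp
  qed
  have A_iff: "\<omega> \<in> A n \<longleftrightarrow> (\<forall>j\<in>{1..<m}.
       \<bar>(apply_cadlag (Y (real m ^ Suc n) \<omega>) (real (Suc j) / real m) -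
          apply_cadlag (Y (real m ^ Suc n) \<omega>) (real j / real m)) - dh j\<bar> < e)"
    if "\<omega> \<in> space M" for n \<omega>
  proof -
    have "X (real (Suc j * m ^ n)) \<omega> - X (real (j * m ^ n)) \<omega> \<in> B n j \<longleftrightarrow>
       \<bar>(apply_cadlag (Y (real m ^ Suc n) \<omega>) (real (Suc j) / real m) -
          apply_cadlag (Y (real m ^ Suc n) \<omega>) (real j / real m)) - dh j\<bar> < e"
      if "j \<in> {1..<m}" for j
    proof -
      have "Suc j \<le> m" "j \<le> m" using that by auto
      then show ?thesis
        unfolding B_def mem_Collect_eq diff_divide_distrib by (simp only: Yeq[OF \<open>\<omega> \<in> space M\<close>])
    qed
    from ball_cong[OF refl this] show ?thesis
      using that unfolding A_def mem_Collect_eq by (simp only: simp_thms)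
  qed
  \<comment> \<open>Radius \<open>e / 2\<close>, because an increment involves the error at two
    points.\<close>
  define U where "U = ball h (e / 2)"
  have sub: "{\<omega>\<in>space M. Y (real m ^ Suc n) \<omega> \<in> U} \<subseteq> A n" for n
  proof
    fix \<omega> assume \<omega>: "\<omega> \<in> {\<omega>\<in>space M. Y (real m ^ Suc n) \<omega> \<in> U}"
    define y where "y = Y (real m ^ Suc n) \<omega>"
    have "norm (y - h) < e / 2"
      using \<omega> by (simp add: U_def y_def dist_norm norm_minus_commute)
    then have *: "\<bar>apply_cadlag y u - apply_cadlag h u\<bar> < e / 2" if "u \<in> {0..1}" for u
      using abs_apply_cadlag_le_norm[OF that, of "y - h"] by (simp add: minus_cadlag.rep_eq)
    have "\<bar>(apply_cadlag y (real (Suc j) / real m) - apply_cadlag y (real j / real m)) - dh j\<bar> < e"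
      if "j \<in> {1..<m}" for j
    proof -
      have "real (Suc j) / real m \<in> {0..1}" "real j / real m \<in> {0..1}" using that by auto
      from this[THEN *] show ?thesis unfolding dh_def by linarith
    qed
    with \<omega> show "\<omega> \<in> A n" using A_iff[of \<omega> n] by (auto simp: y_def)
  qed
  have "real m > 1" using m by simp
  then have pow: "filterlim (\<lambda>n. real m ^ Suc n) at_top sequentially"
    using \<open>real m > 1\<close> by real_asymp
  have "\<forall>\<^sub>F t in at_top. exp (- (1 / 2) * (2 * ln (ln (max t (exp (exp 1)))))) \<le>
      prob {\<omega>\<in>space M. Y t \<omega> \<in> U}"
    by (rule ldp_open_bound[where f=h, OF ldp _ _ h]) (use \<open>e > 0\<close> in \<open>auto simp: U_def\<close>)
  then have "\<forall>\<^sub>F n in sequentially. exp (- (1 / 2) * (2 * ln (ln (max (real m ^ Suc n) (exp (exp 1)))))) \<le>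
      prob {\<omega>\<in>space M. Y (real m ^ Suc n) \<omega> \<in> U}"
    using pow by (rule eventually_compose_filterlim)
  moreover have "\<forall>\<^sub>F n in sequentially. real m ^ Suc n > exp (exp 1)"
    using pow by (simp only: filterlim_at_top_dense)
  ultimately have ev: "\<forall>\<^sub>F n in sequentially. norm (inverse (real (Suc n))) \<le> ln (real m) * prob (A n)"
  proof eventually_elim
    case (elim n)
    have ln: "ln (real m) > 0" using m by simp
    have "exp (- (1 / 2) * (2 * ln (ln (max (real m ^ Suc n) (exp (exp 1)))))) =
        inverse (ln (real m ^ Suc n))"
      using elim(2) one_le_lnln_max[of "real m ^ Suc n"] by (simp only: max_absorb1 less_imp_le) (simp add: exp_minus)
    also have "ln (real m ^ Suc n) = real (Suc n) * ln (real m)"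
      using m by (simp only: ln_realpow)
    finally have "inverse (real (Suc n) * ln (real m)) \<le> prob {\<omega>\<in>space M. Y (real m ^ Suc n) \<omega> \<in> U}"
      using elim(1) by simp
    also have "\<dots> \<le> prob (A n)"
      using A sub by (intro finite_measure_mono) (auto simp: indep_events_def)
    finally have "ln (real m) * inverse (real (Suc n) * ln (real m)) \<le> ln (real m) * prob (A n)"
      using ln by (intro mult_left_mono) auto
    moreover have "ln (real m) * inverse (real (Suc n) * ln (real m)) = inverse (real (Suc n))"
      using ln by (simp add: nonzero_inverse_mult_distrib)
    ultimately have "inverse (real (Suc n)) \<le> ln (real m) * prob (A n)" by (simp only:)
    then show ?case by simp
  qed
  have "\<not> summable (\<lambda>n. prob (A n))"
  proof
    assume "summable (\<lambda>n. prob (A n))"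
    then have "summable (\<lambda>n. ln (real m) * prob (A n))" by (rule summable_mult)
    from summable_comparison_test_ev[OF ev this]
    have "summable (\<lambda>n. inverse (real (Suc n)))" .
    then have "summable (\<lambda>n. inverse (real n))"
      by (subst (asm) summable_Suc_iff)
    then show False using not_summable_harmonic[where 'a=real] by (simp add: inverse_eq_divide)
  qed
  from borel_cantelli_AE2[OF A this] AE_space show ?thesis
  proof eventually_elim
    case (elim \<omega>)
    then show ?case by (simp only: A_iff dh_def)
  qed
qed

end

section \<open>Combining the almost sure statements path by path\<close>

theorem theorem3p2:
  fixes M :: "'a measure"
    and X :: "real \<Rightarrow> 'a \<Rightarrow> real"
    and S :: "real \<Rightarrow> real"
    and \<gamma> \<sigma> :: real
  assumes "prob_space M" and "complete_measure M"
    and "prob_space.additive_process M X"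
    and "\<And>t. t > 0 \<Longrightarrow> (\<lambda>\<omega>. rescaled_path (\<lambda>u. X u \<omega>) t) \<in> borel_measurable M"
    and "\<gamma> > 0" and "\<sigma> > 0"
    and S_def: "S = (\<lambda>t. sqrt (2 * t powr \<gamma> * ln (ln (max t (exp (exp 1))))))"
    and "prob_space.moderate_deviation_principle M X S
           (rate_function \<sigma> \<gamma>) (\<lambda>t. (S t)\<^sup>2 / t powr \<gamma>)"
  shows "(AE \<omega> in M. relatively_compact_at_top
            (\<lambda>t. (1 / S t) *\<^sub>R rescaled_path (\<lambda>u. X u \<omega>) t)) \<and>
         (AE \<omega> in M. limit_points_at_top
            (\<lambda>t. (1 / S t) *\<^sub>R rescaled_path (\<lambda>u. X u \<omega>) t)
              = {f. rate_function \<sigma> \<gamma> f \<le> ennreal (1 / 2)})"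
proof -
  interpret prob_space M by fact
  define I where "I = rate_function \<sigma> \<gamma>"
  define K where "K = {f. I f \<le> ennreal (1 / 2)}"
  define Y where "Y = (\<lambda>t \<omega>. (1 / S t) *\<^sub>R rescaled_path (\<lambda>u. X u \<omega>) t)"
  have S: "S = lil_scale \<gamma>" by (simp add: S_def lil_scale_def fun_eq_iff)
  have X: "cadlag_process X" "independent_increments X"
    using assms(3) by (auto simp: additive_process_def)
  have "large_deviation_principle Y I (\<lambda>t. (S t)\<^sup>2 / t powr \<gamma>)"
    using assms(8) by (simp add: moderate_deviation_principle_def Y_def I_def)
  then have ldp: "large_deviation_principle Y I (\<lambda>t. 2 * ln (ln (max t (exp (exp 1)))))"
    unfolding S by (rule large_deviation_principle_cong) (use lil_speed in auto)
  then have good: "good_rate_function I"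
    by (simp add: large_deviation_principle_def)
  have K: "compact K"
    unfolding K_def by (rule good[unfolded good_rate_function_def, rule_format]) simp
  have "0 \<in> K" by (simp add: K_def I_def rate_function_0)
  then have "K \<noteq> {}" by blast
  have cont: "continuous_on {0..1} (apply_cadlag g)" and zero: "apply_cadlag g 0 = 0" if "g \<in> K" for g
  proof -
    have "rate_function \<sigma> \<gamma> g < \<infinity>"
      using that le_less_trans[OF _ ennreal_less_top, of _ "1 / 2"] unfolding K_def I_def by auto
    from rate_function_finite[OF this]
    show "continuous_on {0..1} (apply_cadlag g)" "apply_cadlag g 0 = 0"
      by (auto intro: absolutely_continuous_on_imp_continuous_on)
  qed
  \<comment> \<open>Multiples of \<open>f\<close> by factors increasing to 1 converge to
    \<open>f\<close> and have rate strictly below 1/2.\<close>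
  have "\<exists>h\<in>{h. I h < ennreal (1 / 2)}. dist h f < e" if f: "f \<in> K" and "e > 0" for f e
  proof -
    have "(\<lambda>n. (1 - 1 / real (n + 2)) *\<^sub>R f) \<longlonglongrightarrow> 1 *\<^sub>R f"
      by (intro tendsto_scaleR tendsto_const) real_asymp
    then have "\<forall>\<^sub>F n in sequentially. dist ((1 - 1 / real (n + 2)) *\<^sub>R f) f < e"
      using tendstoD[OF _ \<open>e > 0\<close>] by simp
    then obtain n where "dist ((1 - 1 / real (n + 2)) *\<^sub>R f) f < e"
      unfolding eventually_sequentially by blast
    moreover have "I ((1 - 1 / real (n + 2)) *\<^sub>R f) < ennreal (1 / 2)"
      unfolding I_def
      by (rule rate_function_scale_less)
        (use f compact_imp_bounded[OF K] in \<open>auto simp: K_def I_def\<close>)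
    ultimately show ?thesis by blast
  qed
  from compact_dense_subset_countable[OF K this]
  obtain D where D: "countable D" "D \<subseteq> {h. I h < ennreal (1 / 2)}"
    "\<And>f e. f \<in> K \<Longrightarrow> e > 0 \<Longrightarrow> \<exists>h\<in>D. dist h f < e" by blast
  have "D \<subseteq> K" using D(2) by (auto simp: K_def)
  \<comment> \<open>Countably many ratios, coming arbitrarily close to 1, as required for filling
    the gaps between geometric times.\<close>
  have "AE \<omega> in M. (\<lambda>n. infdist (Y ((1 + 1 / real (Suc k)) ^ n) \<omega>) K) \<longlonglongrightarrow> 0" for k
    unfolding K_def by (rule AE_infdist_sublevel_tendsto_0[OF ldp]) simp
  then have upper: "AE \<omega> in M. \<forall>k. (\<lambda>n. infdist (Y ((1 + 1 / real (Suc k)) ^ n) \<omega>) K) \<longlonglongrightarrow> 0"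
    by (simp only: AE_all_countable) blast
  have "AE \<omega> in M. \<exists>\<^sub>\<infinity>n. \<forall>j\<in>{1..<m}.
       \<bar>(apply_cadlag (Y (real m ^ Suc n) \<omega>) (real (Suc j) / real m) -
          apply_cadlag (Y (real m ^ Suc n) \<omega>) (real j / real m)) -
        (apply_cadlag h (real (Suc j) / real m) - apply_cadlag h (real j / real m))\<bar> < 1 / (real m)\<^sup>2"
    if "h \<in> D" "m \<in> {2..}" for h and m :: nat
    by (rule AE_grid_increments_infinitely_often[OF X _ Y_def ldp])
      (use that D(2) lil_scale_pos S in auto)
  \<comment> \<open>\<open>D\<close> and the range of \<open>m\<close> are countable, so the
    exceptional null sets can be united.\<close>
  then have lower: "AE \<omega> in M. \<forall>h\<in>D. \<forall>m\<in>{2..}. \<exists>\<^sub>\<infinity>n. \<forall>j\<in>{1..<m}.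
       \<bar>(apply_cadlag (Y (real m ^ Suc n) \<omega>) (real (Suc j) / real m) -
          apply_cadlag (Y (real m ^ Suc n) \<omega>) (real j / real m)) -
        (apply_cadlag h (real (Suc j) / real m) - apply_cadlag h (real j / real m))\<bar> < 1 / (real m)\<^sup>2"
    by (intro AE_ball_countable[THEN iffD2, rule_format] D(1)) auto
  \<comment> \<open>Outside the null sets, the remaining argument is deterministic.\<close>
  have "AE \<omega> in M. relatively_compact_at_top (\<lambda>t. Y t \<omega>) \<and> limit_points_at_top (\<lambda>t. Y t \<omega>) = K"
    using upper lower AE_space
  proof eventually_elim
    case (elim \<omega>)
    have "cadlag_on {0..} (\<lambda>u. X u \<omega>)" using X(1) elim(3) by (simp add: cadlag_process_def)
    then have lim: "((\<lambda>t. infdist (Y t \<omega>) K) \<longlongrightarrow> 0) at_top"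
      by (rule infdist_lil_path_tendsto_0[OF _ \<open>\<gamma> > 0\<close> K \<open>K \<noteq> {}\<close> cont])
        (use elim(1) in \<open>auto simp: Y_def S\<close>)
    show ?case
      using relatively_compact_at_topI[OF K \<open>K \<noteq> {}\<close> lim]
        limit_points_at_top_subset[OF compact_imp_closed[OF K] \<open>K \<noteq> {}\<close> lim]
        limit_points_at_top_supset[OF K \<open>K \<noteq> {}\<close> lim cont zero \<open>D \<subseteq> K\<close> D(3)] elim(2)
      by blast
  qed
  then show ?thesis
    unfolding K_def I_def Y_def by (auto simp: AE_conj_iff)
qed

end
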